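(* Let $(\mathscr{E},\mathscr{L},\mathscr{B})$ be a normal (in particular weakly left-resolving) labelled space over the alphabet $\mathscr{A}$, let $\mathsf{T}$ be its tight spectrum, let $\mathbb{F}$ be the free group generated by $\mathscr{A}$, and let $V_t\subseteq\mathsf{T}$ and $\phi_t:V_{t^{-1}}\to V_t$ ($t\in\mathbb{F}$) be the sets and maps defined in the context. Then $\Phi=(\{V_t\}_{t\in\mathbb{F}},\{\phi_t\}_{t\in\mathbb{F}})$ is a semi-saturated orthogonal partial action of $\mathbb{F}$ on $\mathsf{T}$.
   Context: **Labelled spaces.** A (directed) graph $\mathscr{E}=(\mathscr{E}^0,\mathscr{E}^1,r,s)$ consists of non-empty sets of vertices and edges and range/source maps $r,s:\mathscr{E}^1\to\mathscr{E}^0$. A path is a finite or infinite sequence of edges $\lambda_1\lambda_2\ldots$ with $r(\lambda_i)=s(\lambda_{i+1})$. A labelled graph is a graph with a surjective labelling map $\mathscr{L}:\mathscr{E}^1\to\mathscr{A}$ onto a non-empty set $\mathscr{A}$ (the alphabet), extended letterwise to paths. $\mathscr{L}^{\geq 1}$ is the set of labels of finite paths of length $\geq 1$; $\mathscr{L}^*=\{\omega\}\cup\mathscr{L}^{\geq1}$ with $\omega$ the empty word; $\overline{\mathscr{L}^\infty}$ is the set of infinite words over $\mathscr{A}$ all of whose finite beginnings lie in $\mathscr{L}^*$; $\overline{\mathscr{L}^{\leq\infty}}=\mathscr{L}^*\cup\overline{\mathscr{L}^\infty}$. $|\alpha|$ is the length of $\alpha$; $\alpha_{i,j}=\alpha_i\cdots\alpha_j$,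 and $\alpha_{i,j}=\omega$ if $j<i$. For $A\subseteq\mathscr{E}^0$: $r(A,\alpha)=\{r(\lambda): \mathscr{L}(\lambda)=\alpha,\ s(\lambda)\in A\}$ for $\alpha\in\mathscr{L}^{\geq1}$, $r(A,\omega)=A$, and $r(\alpha)=r(\mathscr{E}^0,\alpha)$. A labelled space is a triple $(\mathscr{E},\mathscr{L},\mathscr{B})$ with $\mathscr{B}$ a family of subsets of $\mathscr{E}^0$ closed under finite intersections and finite unions, containing $r(\alpha)$ for all $\alpha\in\mathscr{L}^{\geq1}$, and with $r(A,\alpha)\in\mathscr{B}$ for $A\in\mathscr{B}$, $\alpha\in\mathscr{L}^*$. It is weakly left-resolving if $r(A\cap B,\alpha)=r(A,\alpha)\cap r(B,\alpha)$ for all $A,B\in\mathscr{B}$, $\alpha\in\mathscr{L}^{\geq 1}$; it is normal if it is weakly left-resolving and $\mathscr{B}$ is closed under relative complements. $\mathscr{B}_\alpha=\{A\in\mathscr{B}: A\subseteq r(\alpha)\}$ (so $\mathscr{B}_\omega=\mathscr{B}$). **Tight spectrum.** $E(S)=\{(\alpha,A,\alpha):\alpha\in\mathscr{L}^*,\ \emptyset\neq A\in\mathscr{B}_\alpha\}\cup\{0\}$ is a meet semilattice with zero, where for non-zero elements $(\alpha,A,\alpha)\leq(\beta,B,\beta)$ iff $\alpha=\beta\alpha'$ and $A\subseteq r(B,\alpha')$. A filter in $E(S)$ is a non-empty upward closed subset, closed under meets, not containing $0$; ultrafilters are maximal filters. Filters are identified with their characteristic functions, given the topology of pointwise convergence;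 the tight spectrum $\mathsf{T}$ is the closure of the set of ultrafilters; its elements are the tight filters. For $e\in E(S)$, $V_e=\{\xi\in\mathsf{T}:e\in\xi\}$; the sets $V_{e:e_1,\dots,e_n}=V_e\setminus(V_{e_1}\cup\dots\cup V_{e_n})$ form a basis of compact-open sets of the Hausdorff space $\mathsf{T}$. Each tight filter $\xi$ has an associated word $\alpha\in\overline{\mathscr{L}^{\leq\infty}}$ (write $\xi=\xi^\alpha$) and filters $\xi_n=\{A\in\mathscr{B}:(\alpha_{1,n},A,\alpha_{1,n})\in\xi\}$, $0\le n\le|\alpha|$ ($n<\infty$), where $\xi_0$ may be empty; $(\beta,A,\beta)\in\xi^\alpha$ iff $\beta$ is a beginning of $\alpha$ and $A\in\xi_{|\beta|}$, and $\xi$ is determined by $\alpha$ and the family $\{\xi_n\}$. $\mathsf{T}_\alpha$ denotes the tight filters with word $\alpha$. **Gluing and cutting maps.** For $\alpha\in\mathscr{L}^{\geq1}$ and $\beta\in\overline{\mathscr{L}^{\leq\infty}}$ with $\alpha\beta\in\overline{\mathscr{L}^{\leq\infty}}$, let $\mathsf{T}_{(\alpha)\beta}=\{\xi\in\mathsf{T}_\beta:\xi_0\text{ is an ultrafilter in }\mathscr{B}\text{ with }r(\alpha)\in\xi_0\}$. The map $G_{(\alpha)\beta}:\mathsf{T}_{(\alpha)\beta}\to\mathsf{T}_{\alpha\beta}$ sends $\xi$ to $\eta$, where: if $\beta=\omega$, $\eta_{|\alpha|}=\{C\cap r(\alpha):C\in\xi_0\}$ and $\eta_i=\{D\in\mathscr{B}_{\alpha_{1,i}}:r(D,\alpha_{i+1,|\alpha|})\in\eta_{|\alpha|}\}$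 for $0\leq i<|\alpha|$; if $\beta\neq\omega$, $\eta_{|\alpha|+n}=\{C\cap r(\alpha\beta_{1,n}):C\in\xi_n\}$ for $1\leq n\leq|\beta|$ ($n<\infty$) and $\eta_i=\{D\in\mathscr{B}_{\alpha_{1,i}}:r(D,\alpha_{i+1,|\alpha|}\beta_1)\in\eta_{|\alpha|+1}\}$ for $0\le i\le|\alpha|$. Its inverse $H_{[\alpha]\beta}:\mathsf{T}_{\alpha\beta}\to\mathsf{T}_{(\alpha)\beta}$ sends $\xi$ to $\eta$ with $\eta_n=\{C\in\mathscr{B}_{\beta_{1,n}}:D\subseteq C\text{ for some }D\in\xi_{n+|\alpha|}\}$, $0\le n\le|\beta|$ ($n<\infty$). For $\alpha=\omega$ both maps are the identity of $\mathsf{T}_\beta$. **The sets $V_t$ and maps $\phi_t$.** Identify the identity of $\mathbb{F}$ with $\omega$ and words over $\mathscr{A}$ with elements of $\mathbb{F}$. Put $V_\omega=\mathsf{T}$, $\phi_\omega=\mathrm{id}$; for $a\in\mathscr{A}$, $V_a=V_{(a,r(a),a)}$ (the disjoint union of the $\mathsf{T}_{a\beta}$), $V_{a^{-1}}=V_{(\omega,r(a),\omega)}$ (the disjoint union of the $\mathsf{T}_{(a)\beta}$), $\phi_a|_{\mathsf{T}_{(a)\beta}}=G_{(a)\beta}$, and $\phi_{a^{-1}}=\phi_a^{-1}$, i.e. $\phi_{a^{-1}}|_{\mathsf{T}_{a\beta}}=H_{[a]\beta}$. For $t=a_n\cdots a_1$ reduced, $a_i\in\mathscr{A}\cup\mathscr{A}^{-1}$,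 $n\geq2$, inductively $V_{t^{-1}}=\phi_{a_{n-1}\cdots a_1}^{-1}(V_{a_n^{-1}})$ and $\phi_t(\xi)=\phi_{a_n}(\phi_{a_{n-1}\cdots a_1}(\xi))$ for $\xi\in V_{t^{-1}}$. **Partial actions.** A partial action of a group $G$ with identity $e$ on a topological space $X$ is a pair $(\{V_t\}_{t\in G},\{\phi_t\}_{t\in G})$ of open sets $V_t\subseteq X$ and homeomorphisms $\phi_t:V_{t^{-1}}\to V_t$ such that (1) $V_e=X$ and $\phi_e=\mathrm{id}_X$; (2) $\phi_s(V_{s^{-1}}\cap V_t)=V_s\cap V_{st}$; (3) $\phi_s(\phi_t(x))=\phi_{st}(x)$ for $x\in V_{t^{-1}}\cap V_{(st)^{-1}}$. A partial action of the free group $\mathbb{F}$ is semi-saturated if $\phi_s\circ\phi_t=\phi_{st}$ (with the composition defined on its natural domain) whenever $|st|=|s|+|t|$ (reduced word length), and orthogonal if $V_a\cap V_b=\emptyset$ for distinct generators $a\neq b$ in $\mathscr{A}$. *)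

theory Defs
  imports
    "HOL-Analysis.Abstract_Topology"
    "HOL-Analysis.Function_Topology"
    "HOL-Algebra.Group"
    "HOL-Library.Stream"
    "Graph_Theory.Arc_Walk"
begin

section \<open>The free group on a set of generators\<close>

datatype 'a letter = Pos 'a | Neg 'a

fun gen :: "'a letter \<Rightarrow> 'a" where
  "gen (Pos a) = a"
| "gen (Neg a) = a"

fun inv_letter :: "'a letter \<Rightarrow> 'a letter" where
  "inv_letter (Pos a) = Neg a"
| "inv_letter (Neg a) = Pos a"

definition reduced :: "'a letter list \<Rightarrow> bool" where
  "reduced xs \<longleftrightarrow> successively (\<lambda>x y. y \<noteq> inv_letter x) xs"

fun push :: "'a letter \<Rightarrow> 'a letter list \<Rightarrow> 'a letter list" where
  "push x [] = [x]"
| "push x (y # ys) = (if y = inv_letter x then ys else x # y # ys)"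

definition reduce :: "'a letter list \<Rightarrow> 'a letter list" where
  "reduce xs = foldr push xs []"

definition free_group :: "'a set \<Rightarrow> 'a letter list monoid" where
  "free_group A =
     \<lparr>carrier = {xs. reduced xs \<and> gen ` set xs \<subseteq> A},
      mult = (\<lambda>xs ys. reduce (xs @ ys)),
      one = []\<rparr>"

lemma inv_letter_inv_letter [simp]: "inv_letter (inv_letter x) = x"
  by (cases x) auto

lemma gen_inv_letter [simp]: "gen (inv_letter x) = gen x"
  by (cases x) auto

lemma inv_letter_neq [simp]: "inv_letter x \<noteq> x" "x \<noteq> inv_letter x"
  by (cases x; simp)+

lemma inv_letter_eq_iff [simp]: "inv_letter x = inv_letter y \<longleftrightarrow> x = y"
  by (metis inv_letter_inv_letter)

lemma reduced_Nil [simp]: "reduced []"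
  by (simp add: reduced_def)

lemma reduced_single [simp]: "reduced [x]"
  by (simp add: reduced_def)

lemma reduced_Cons2 [simp]:
  "reduced (x # y # ys) \<longleftrightarrow> y \<noteq> inv_letter x \<and> reduced (y # ys)"
  by (simp add: reduced_def)

lemma reduced_ConsD: "reduced (x # xs) \<Longrightarrow> reduced xs"
  by (cases xs) auto

lemma reduced_push: "reduced xs \<Longrightarrow> reduced (push x xs)"
  by (cases xs) (auto dest: reduced_ConsD)

lemma push_eq_Cons: "reduced (x # xs) \<Longrightarrow> push x xs = x # xs"
  by (cases xs) auto

lemma push_push_inv: "reduced xs \<Longrightarrow> push x (push (inv_letter x) xs) = xs"
  by (cases xs) (auto simp: push_eq_Cons)

lemma reduced_foldr_push: "reduced ys \<Longrightarrow> reduced (foldr push xs ys)"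
  by (induction xs) (auto simp: reduced_push)

lemma reduced_reduce: "reduced (reduce xs)"
  by (simp add: reduce_def reduced_foldr_push)

lemma reduce_reduced: "reduced xs \<Longrightarrow> reduce xs = xs"
  unfolding reduce_def
proof (induction xs)
  case (Cons x xs)
  then show ?case using push_eq_Cons[of x xs] reduced_ConsD[of x xs] by simp
qed simp

lemma foldr_push_push:
  assumes "reduced ys"
  shows "foldr push (push x xs) ys = push x (foldr push xs ys)"
proof (cases xs)
  case (Cons y zs)
  then show ?thesis
    using push_push_inv[OF reduced_foldr_push[OF assms]] by auto
qed simp

lemma foldr_push_reduce:
  "reduced ys \<Longrightarrow> foldr push (reduce xs) ys = foldr push xs ys"
  by (induction xs) (auto simp: reduce_def foldr_push_push)

lemma reduce_append: "reduce (xs @ ys) = foldr push xs (reduce ys)"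
  by (simp add: reduce_def)

lemma reduce_reduce_left: "reduce (reduce xs @ ys) = reduce (xs @ ys)"
  by (simp add: reduce_append foldr_push_reduce reduced_reduce)

lemma reduce_reduce_right: "reduce (xs @ reduce ys) = reduce (xs @ ys)"
  by (simp add: reduce_append reduce_reduced reduced_reduce)

lemma set_push: "set (push x xs) \<subseteq> insert x (set xs)"
  by (cases xs) auto

lemma set_reduce: "set (reduce xs) \<subseteq> set xs"
  unfolding reduce_def
proof (induction xs)
  case (Cons x xs)
  then show ?case using set_push[of x "foldr push xs []"] by auto
qed simp

lemma reduce_inverse: "reduce (map inv_letter (rev xs) @ xs) = []"
proof (induction xs)
  case (Cons x xs)
  have "reduce (map inv_letter (rev (x # xs)) @ x # xs)
      = foldr push (map inv_letter (rev xs)) (push (inv_letter x) (push x (reduce xs)))"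
    by (simp add: reduce_def)
  also have "push (inv_letter x) (push x (reduce xs)) = reduce xs"
    using push_push_inv[OF reduced_reduce, of "inv_letter x"] by simp
  finally show ?case using Cons by (simp add: reduce_append)
qed (simp add: reduce_def)

lemma reduced_inverse: "reduced xs \<Longrightarrow> reduced (map inv_letter (rev xs))"
  unfolding reduced_def successively_map successively_rev
  by (erule successively_mono) auto

lemma group_free_group: "group (free_group A)"
proof (rule groupI)
  fix x y z assume "x \<in> carrier (free_group A)" "y \<in> carrier (free_group A)"
    "z \<in> carrier (free_group A)"
  then show "x \<otimes>\<^bsub>free_group A\<^esub> y \<otimes>\<^bsub>free_group A\<^esub> z
      = x \<otimes>\<^bsub>free_group A\<^esub> (y \<otimes>\<^bsub>free_group A\<^esub> z)"
    by (simp add: free_group_def reduce_reduce_left reduce_reduce_right)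
next
  fix x y assume "x \<in> carrier (free_group A)" "y \<in> carrier (free_group A)"
  then show "x \<otimes>\<^bsub>free_group A\<^esub> y \<in> carrier (free_group A)"
    using set_reduce[of "x @ y"] by (fastforce simp: free_group_def reduced_reduce)
next
  fix x assume x: "x \<in> carrier (free_group A)"
  have "map inv_letter (rev x) \<in> carrier (free_group A)"
    using x by (auto simp: free_group_def reduced_inverse)
  moreover have "map inv_letter (rev x) \<otimes>\<^bsub>free_group A\<^esub> x = \<one>\<^bsub>free_group A\<^esub>"
    by (simp add: free_group_def reduce_inverse)
  ultimately show "\<exists>y\<in>carrier (free_group A). y \<otimes>\<^bsub>free_group A\<^esub> x = \<one>\<^bsub>free_group A\<^esub>"
    by blast
qed (auto simp: free_group_def reduce_reduced)

lemma inv_free_group: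
  assumes "x \<in> carrier (free_group A)"
  shows "inv\<^bsub>free_group A\<^esub> x = map inv_letter (rev x)"
proof (rule group.inv_equality[OF group_free_group])
  show "map inv_letter (rev x) \<otimes>\<^bsub>free_group A\<^esub> x = \<one>\<^bsub>free_group A\<^esub>"
    by (simp add: free_group_def reduce_inverse)
  show "map inv_letter (rev x) \<in> carrier (free_group A)"
    using assms by (auto simp: free_group_def reduced_inverse)
qed (fact assms)


section \<open>Partial actions\<close>

text \<open>
  The map \<open>\<phi> t\<close> is only meaningful on \<open>V (inv t)\<close>; no clause depends on its values elsewhere.
\<close>

locale partial_action = group G for G :: "'g monoid" (structure) +
  fixes X :: "'x topology" and V :: "'g \<Rightarrow> 'x set" and \<phi> :: "'g \<Rightarrow> 'x \<Rightarrow> 'x"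
  assumes openin_V: "t \<in> carrier G \<Longrightarrow> openin X (V t)"
    and homeo: "t \<in> carrier G \<Longrightarrow>
      homeomorphic_map (subtopology X (V (inv t))) (subtopology X (V t)) (\<phi> t)"
    and V_one: "V \<one> = topspace X"
    and \<phi>_one: "x \<in> topspace X \<Longrightarrow> \<phi> \<one> x = x"
    and image: "\<lbrakk>s \<in> carrier G; t \<in> carrier G\<rbrakk> \<Longrightarrow>
      \<phi> s ` (V (inv s) \<inter> V t) = V s \<inter> V (s \<otimes> t)"
    and comp: "\<lbrakk>s \<in> carrier G; t \<in> carrier G; x \<in> V (inv t) \<inter> V (inv (s \<otimes> t))\<rbrakk> \<Longrightarrow>
      \<phi> s (\<phi> t x) = \<phi> (s \<otimes> t) x"

text \<open>
  Elements of \<open>free_group A\<close> are reduced words, so \<open>length\<close> is the reduced word length. The two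
  conclusions say that \<open>\<phi> s \<circ> \<phi> t\<close>, on its natural domain, and \<open>\<phi> (s \<otimes> t)\<close> agree as partial maps.
\<close>

definition semi_saturated ::
  "'a set \<Rightarrow> ('a letter list \<Rightarrow> 'x set) \<Rightarrow> ('a letter list \<Rightarrow> 'x \<Rightarrow> 'x) \<Rightarrow> bool" where
  "semi_saturated A V \<phi> \<longleftrightarrow>
     (let F = free_group A in
      \<forall>s\<in>carrier F. \<forall>t\<in>carrier F.
        length (s \<otimes>\<^bsub>F\<^esub> t) = length s + length t \<longrightarrow>
          {x \<in> V (inv\<^bsub>F\<^esub> t). \<phi> t x \<in> V (inv\<^bsub>F\<^esub> s)} = V (inv\<^bsub>F\<^esub> (s \<otimes>\<^bsub>F\<^esub> t)) \<and>
          (\<forall>x\<in>V (inv\<^bsub>F\<^esub> (s \<otimes>\<^bsub>F\<^esub> t)). \<phi> s (\<phi> t x) = \<phi> (s \<otimes>\<^bsub>F\<^esub> t) x))"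

definition orthogonal_action :: "'a set \<Rightarrow> ('a letter list \<Rightarrow> 'x set) \<Rightarrow> bool" where
  "orthogonal_action A V \<longleftrightarrow>
     (\<forall>a\<in>A. \<forall>b\<in>A. a \<noteq> b \<longrightarrow> V [Pos a] \<inter> V [Pos b] = {})"


section \<open>Finite and infinite words\<close>

datatype 'a word = FinW "'a list" | InfW "'a stream"

fun wtake :: "nat \<Rightarrow> 'a word \<Rightarrow> 'a list" where
  "wtake n (FinW xs) = take n xs"
| "wtake n (InfW s) = stake n s"

fun wdrop :: "nat \<Rightarrow> 'a word \<Rightarrow> 'a word" where
  "wdrop n (FinW xs) = FinW (drop n xs)"
| "wdrop n (InfW s) = InfW (sdrop n s)"

fun wappend :: "'a list \<Rightarrow> 'a word \<Rightarrow> 'a word" where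
  "wappend xs (FinW ys) = FinW (xs @ ys)"
| "wappend xs (InfW s) = InfW (xs @- s)"

definition beginning :: "'a list \<Rightarrow> 'a word \<Rightarrow> bool" where
  "beginning \<beta> \<alpha> \<longleftrightarrow> wtake (length \<beta>) \<alpha> = \<beta>"


section \<open>Labelled spaces\<close>

locale labelled_graph = wf_digraph \<E> for \<E> :: "('v, 'e) pre_digraph" (structure) +
  fixes L :: "'e \<Rightarrow> 'a" and \<A> :: "'a set"
  assumes verts_nonempty: "verts \<E> \<noteq> {}"
    and arcs_nonempty: "arcs \<E> \<noteq> {}"
    and label_surj: "L ` arcs \<E> = \<A>"
begin

definition labels1 :: "'a list set" where
  "labels1 = {map L p | p u v. awalk u p v \<and> p \<noteq> []}"

definition labels :: "'a list set" where
  "labels = insert [] labels1"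

definition rel_range :: "'v set \<Rightarrow> 'a list \<Rightarrow> 'v set" where
  "rel_range A \<alpha> =
     (if \<alpha> = [] then A else {v. \<exists>u\<in>A. \<exists>p. awalk u p v \<and> map L p = \<alpha>})"

definition rng :: "'a list \<Rightarrow> 'v set" where
  "rng \<alpha> = rel_range (verts \<E>) \<alpha>"

end

text \<open>
  \<open>Idm \<alpha> A\<close> stands for the idempotent \<open>(\<alpha>, A, \<alpha>)\<close>.
\<close>

datatype ('a, 'v) idem = Zero | Idm "'a list" "'v set"

locale labelled_space = labelled_graph \<E> L \<A>
  for \<E> :: "('v, 'e) pre_digraph" (structure) and L :: "'e \<Rightarrow> 'a" and \<A> :: "'a set" +
  fixes \<B> :: "'v set set"
  assumes \<B>_subset: "A \<in> \<B> \<Longrightarrow> A \<subseteq> verts \<E>"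
    and \<B>_Int: "\<lbrakk>A \<in> \<B>; B \<in> \<B>\<rbrakk> \<Longrightarrow> A \<inter> B \<in> \<B>"
    and \<B>_Un: "\<lbrakk>A \<in> \<B>; B \<in> \<B>\<rbrakk> \<Longrightarrow> A \<union> B \<in> \<B>"
    and \<B>_rng: "\<alpha> \<in> labels1 \<Longrightarrow> rng \<alpha> \<in> \<B>"
    and \<B>_rel_range: "\<lbrakk>A \<in> \<B>; \<alpha> \<in> labels\<rbrakk> \<Longrightarrow> rel_range A \<alpha> \<in> \<B>"
begin

definition weakly_left_resolving :: bool where
  "weakly_left_resolving \<longleftrightarrow>
     (\<forall>A\<in>\<B>. \<forall>B\<in>\<B>. \<forall>\<alpha>\<in>labels1. rel_range (A \<inter> B) \<alpha> = rel_range A \<alpha> \<inter> rel_range B \<alpha>)"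

definition \<B>_at :: "'a list \<Rightarrow> 'v set set" where
  "\<B>_at \<alpha> = {A \<in> \<B>. A \<subseteq> rng \<alpha>}"


subsection \<open>The tight spectrum\<close>

definition ES :: "('a, 'v) idem set" where
  "ES = insert Zero {Idm \<alpha> A | \<alpha> A. \<alpha> \<in> labels \<and> A \<noteq> {} \<and> A \<in> \<B>_at \<alpha>}"

fun ES_le :: "('a, 'v) idem \<Rightarrow> ('a, 'v) idem \<Rightarrow> bool" where
  "ES_le Zero y = True"
| "ES_le (Idm \<alpha> A) Zero = False"
| "ES_le (Idm \<alpha> A) (Idm \<beta> B) = (\<exists>\<alpha>'. \<alpha> = \<beta> @ \<alpha>' \<and> A \<subseteq> rel_range B \<alpha>')"

definition is_meet :: "('a, 'v) idem \<Rightarrow> ('a, 'v) idem \<Rightarrow> ('a, 'v) idem \<Rightarrow> bool" where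
  "is_meet x y z \<longleftrightarrow> z \<in> ES \<and> ES_le z x \<and> ES_le z y \<and>
     (\<forall>w\<in>ES. ES_le w x \<and> ES_le w y \<longrightarrow> ES_le w z)"

definition is_filter :: "('a, 'v) idem set \<Rightarrow> bool" where
  "is_filter \<xi> \<longleftrightarrow> \<xi> \<subseteq> ES \<and> \<xi> \<noteq> {} \<and> Zero \<notin> \<xi> \<and>
     (\<forall>x\<in>\<xi>. \<forall>y\<in>ES. ES_le x y \<longrightarrow> y \<in> \<xi>) \<and>
     (\<forall>x\<in>\<xi>. \<forall>y\<in>\<xi>. \<exists>z\<in>\<xi>. is_meet x y z)"

definition is_ultrafilter :: "('a, 'v) idem set \<Rightarrow> bool" where
  "is_ultrafilter \<xi> \<longleftrightarrow> is_filter \<xi> \<and> (\<forall>\<zeta>. is_filter \<zeta> \<and> \<xi> \<subseteq> \<zeta> \<longrightarrow> \<zeta> = \<xi>)"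

definition filter_topology :: "('a, 'v) idem set topology" where
  "filter_topology =
     pullback_topology {\<xi>. is_filter \<xi>} (\<lambda>\<xi>. \<lambda>e\<in>ES. e \<in> \<xi>)
       (product_topology (\<lambda>_. discrete_topology (UNIV :: bool set)) ES)"

definition tight :: "('a, 'v) idem set set" where
  "tight = filter_topology closure_of {\<xi>. is_ultrafilter \<xi>}"

definition tight_spectrum :: "('a, 'v) idem set topology" where
  "tight_spectrum = subtopology filter_topology tight"

definition V_idem :: "('a, 'v) idem \<Rightarrow> ('a, 'v) idem set set" where
  "V_idem e = {\<xi> \<in> tight. e \<in> \<xi>}"

text \<open>
  The word of a filter is determined by its finite beginnings. The empty word is inserted by hand
  because the level \<open>\<xi>\<^sub>0\<close> may be empty, in which case no element of \<open>\<xi>\<close> has first component \<open>[]\<close>.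
\<close>

definition word_of :: "('a, 'v) idem set \<Rightarrow> 'a word" where
  "word_of \<xi> = (THE \<alpha>. {\<beta>. beginning \<beta> \<alpha>} = insert [] {\<beta>. \<exists>A. Idm \<beta> A \<in> \<xi>})"

text \<open>
  \<open>level \<alpha> \<xi> n\<close> is \<open>\<xi>\<^sub>n\<close> for a filter \<open>\<xi>\<close> with word \<open>\<alpha>\<close>, and \<open>assemble\<close> recovers a filter from its
  word and its levels; levels beyond the length of the word are ignored.
\<close>

definition level :: "'a word \<Rightarrow> ('a, 'v) idem set \<Rightarrow> nat \<Rightarrow> 'v set set" where
  "level \<alpha> \<xi> n = {A \<in> \<B>. Idm (wtake n \<alpha>) A \<in> \<xi>}"

definition assemble :: "'a word \<Rightarrow> (nat \<Rightarrow> 'v set set) \<Rightarrow> ('a, 'v) idem set" where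
  "assemble \<alpha> F = {Idm \<beta> A | \<beta> A. beginning \<beta> \<alpha> \<and> A \<in> F (length \<beta>)}"


subsection \<open>Gluing and cutting\<close>

definition glue_level :: "'a list \<Rightarrow> 'a word \<Rightarrow> ('a, 'v) idem set \<Rightarrow> nat \<Rightarrow> 'v set set" where
  "glue_level \<alpha> \<beta> \<xi> i =
     (if \<beta> = FinW [] then
        let top_level = {C \<inter> rng \<alpha> | C. C \<in> level \<beta> \<xi> 0} in
        if i < length \<alpha> then {D \<in> \<B>_at (take i \<alpha>). rel_range D (drop i \<alpha>) \<in> top_level}
        else top_level
      else
        let upper = (\<lambda>n. {C \<inter> rng (\<alpha> @ wtake n \<beta>) | C. C \<in> level \<beta> \<xi> n}) in
        if i \<le> length \<alpha>
        then {D \<in> \<B>_at (take i \<alpha>). rel_range D (drop i \<alpha> @ wtake 1 \<beta>) \<in> upper 1}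
        else upper (i - length \<alpha>))"

definition glue :: "'a list \<Rightarrow> 'a word \<Rightarrow> ('a, 'v) idem set \<Rightarrow> ('a, 'v) idem set" where
  "glue \<alpha> \<beta> \<xi> = (if \<alpha> = [] then \<xi> else assemble (wappend \<alpha> \<beta>) (glue_level \<alpha> \<beta> \<xi>))"

definition cut_level :: "'a list \<Rightarrow> 'a word \<Rightarrow> ('a, 'v) idem set \<Rightarrow> nat \<Rightarrow> 'v set set" where
  "cut_level \<alpha> \<beta> \<xi> n =
     {C \<in> \<B>_at (wtake n \<beta>). \<exists>D \<in> level (wappend \<alpha> \<beta>) \<xi> (n + length \<alpha>). D \<subseteq> C}"

definition cut :: "'a list \<Rightarrow> 'a word \<Rightarrow> ('a, 'v) idem set \<Rightarrow> ('a, 'v) idem set" where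
  "cut \<alpha> \<beta> \<xi> = (if \<alpha> = [] then \<xi> else assemble \<beta> (cut_level \<alpha> \<beta> \<xi>))"


subsection \<open>The sets and maps indexed by the free group\<close>

fun V_letter :: "'a letter \<Rightarrow> ('a, 'v) idem set set" where
  "V_letter (Pos a) = V_idem (Idm [a] (rng [a]))"
| "V_letter (Neg a) = V_idem (Idm [] (rng [a]))"

text \<open>
  A point of \<open>V_letter (Pos a)\<close> has a word of the form \<open>a\<beta>\<close>, and \<open>wdrop 1\<close> returns \<open>\<beta>\<close>.
\<close>

fun \<phi>_letter :: "'a letter \<Rightarrow> ('a, 'v) idem set \<Rightarrow> ('a, 'v) idem set" where
  "\<phi>_letter (Pos a) \<xi> = glue [a] (word_of \<xi>) \<xi>"
| "\<phi>_letter (Neg a) \<xi> = cut [a] (wdrop 1 (word_of \<xi>)) \<xi>"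

fun \<phi> :: "'a letter list \<Rightarrow> ('a, 'v) idem set \<Rightarrow> ('a, 'v) idem set" where
  "\<phi> [] \<xi> = \<xi>"
| "\<phi> [a] \<xi> = \<phi>_letter a \<xi>"
| "\<phi> (a # b # t) \<xi> = \<phi>_letter a (\<phi> (b # t) \<xi>)"

text \<open>
  \<open>V_inv t\<close> is the set indexed by the inverse of \<open>t\<close>, that is, the domain of \<open>\<phi> t\<close>.
\<close>

fun V_inv :: "'a letter list \<Rightarrow> ('a, 'v) idem set set" where
  "V_inv [] = tight"
| "V_inv [a] = V_letter (inv_letter a)"
| "V_inv (a # b # t) = {\<xi> \<in> V_inv (b # t). \<phi> (b # t) \<xi> \<in> V_letter (inv_letter a)}"

definition V :: "'a letter list \<Rightarrow> ('a, 'v) idem set set" where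
  "V t = V_inv (inv\<^bsub>free_group \<A>\<^esub> t)"

end

locale normal_labelled_space = labelled_space +
  assumes wlr: weakly_left_resolving
    and \<B>_Diff: "\<lbrakk>A \<in> \<B>; B \<in> \<B>\<rbrakk> \<Longrightarrow> A - B \<in> \<B>"

end

theory Submission
  imports Defs "HOL-Library.Sublist"
begin

text \<open>
  Any family of homeomorphisms between open sets, one for each letter and with inverse letters
  giving inverse maps, generates a semi-saturated partial action of the free group: concatenating
  words composes the partial maps, and cancelling a pair of inverse letters only enlarges the domain.

  For the letter \<open>a\<close>, gluing and cutting are conjugation by \<open>(a, r(a), \<omega>)\<close>. Conjugation is a
  monotone homeomorphism from the open set of all filters containing \<open>(\<omega>, r(a), \<omega>)\<close> onto the open
  set of all filters containing \<open>(a, r(a), a)\<close>. Both sets of filters are upward closed under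
  inclusion, so it matches ultrafilters with ultrafilters, and being a homeomorphism between open
  sets it matches their limits, the tight filters. No description of the tight filters is needed.
\<close>

section \<open>Partial actions of free groups generated by partial homeomorphisms\<close>

text \<open>Cancellation can strictly enlarge a domain, so the axioms cannot be checked on reduced
  words alone. \<open>act\<close> and \<open>act_dom\<close> are therefore defined on all words, and
  each inclusion is proved by exhibiting an unreduced word that is already defined at the point and
  only then reducing it. On the side of filters, the vertex set need not belong to \<B>, so
  \<open>[]\<close> often needs separate care; what helps is that both domains contain a fixed
  idempotent, \<open>Idm [] (rng [a])\<close> or \<open>Idm [a] (rng [a])\<close>. Weak
  left-resolving enters because ranges then commute with intersections: the meet of
  \<open>Idm \<alpha> A\<close> and \<open>Idm (\<alpha> @ \<beta>) B\<close>, when non-zero, has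
  the set \<open>rel_range A \<beta> \<inter> B\<close>. Consequently a level of a filter is the
  pullback of any later non-empty level, and this is what reconciles the two formulas for gluing
  (empty and non-empty word) with the single formula for conjugation.\<close>

definition inv_word :: "'a letter list \<Rightarrow> 'a letter list" where
  "inv_word w = map inv_letter (rev w)"

lemma inv_word_simps [simp]:
  "inv_word [] = []"
  "inv_word (x # w) = inv_word w @ [inv_letter x]"
  "inv_word (inv_word w) = w"
  by (simp_all add: inv_word_def rev_map o_def)

section \<open>Concatenations without cancellation\<close>

lemma length_push_le: "length (push x ys) \<le> Suc (length ys)"
  by (cases ys) auto

lemma push_eq_Cons_if_length: "length (push x ys) = Suc (length ys) \<Longrightarrow> push x ys = x # ys"
  by (cases ys) (auto split: if_splits)

lemma length_foldr_push_le: "length (foldr push xs ys) \<le> length xs + length ys"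
  by (induction xs) (auto intro: order_trans[OF length_push_le])

text \<open>Each \<open>push\<close> adds at most one letter, so a result of full length leaves no
  room for a cancellation at any step.\<close>

lemma foldr_push_eq_append:
  "length (foldr push xs ys) = length xs + length ys \<Longrightarrow> foldr push xs ys = xs @ ys"
proof (induction xs)
  case (Cons x xs)
  have "length (foldr push xs ys) = length xs + length ys"
    using Cons.prems length_push_le[of x "foldr push xs ys"] length_foldr_push_le[of xs ys] by simp
  then show ?case
    using Cons push_eq_Cons_if_length[of x "xs @ ys"] by simp
qed simp

lemma reduce_append_if_length:
  assumes "reduced t" "length (reduce (s @ t)) = length s + length t"
  shows "reduce (s @ t) = s @ t"
  using foldr_push_eq_append[of s t] assms by (simp add: reduce_append reduce_reduced)

text \<open>\<open>D x\<close> is the range of \<open>f x\<close> and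
  \<open>D (inv_letter x)\<close> its domain. As \<open>x\<close> runs through all letters and
  \<open>inv_letter\<close> is an involution, the one-sided law \<open>f_inverse\<close> gives
  inverses on both sides.\<close>

locale letter_homeos =
  fixes X :: "'x topology" and D :: "'a letter \<Rightarrow> 'x set" and f :: "'a letter \<Rightarrow> 'x \<Rightarrow> 'x"
  assumes openin_D: "openin X (D x)"
    and continuous_f:
      "continuous_map (subtopology X (D (inv_letter x))) (subtopology X (D x)) (f x)"
    and f_inverse: "y \<in> D (inv_letter x) \<Longrightarrow> f (inv_letter x) (f x y) = y"
begin

abbreviation act :: "'a letter list \<Rightarrow> 'x \<Rightarrow> 'x" where
  "act w \<equiv> foldr f w"

fun act_dom :: "'a letter list \<Rightarrow> 'x set" where
  "act_dom [] = topspace X"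
| "act_dom (x # w) = {y \<in> act_dom w. act w y \<in> D (inv_letter x)}"

lemma D_subset: "D x \<subseteq> topspace X"
  by (rule openin_subset[OF openin_D])

lemma f_maps: "y \<in> D (inv_letter x) \<Longrightarrow> f x y \<in> D x"
  using continuous_map_image_subset_topspace[OF continuous_f[of x]] D_subset[of "inv_letter x"]
  by (auto simp: topspace_subtopology)

lemma dom_act_topspace: "y \<in> act_dom w \<Longrightarrow> act w y \<in> topspace X"
  by (cases w) (use f_maps D_subset in auto)

text \<open>This is the natural domain of a composition, with no reducedness required. For empty
  \<open>s\<close> it rests on values of \<open>act t\<close> staying in the space.\<close>

lemma dom_append: "act_dom (s @ t) = {y \<in> act_dom t. act t y \<in> act_dom s}"
  by (induction s) (auto dest: dom_act_topspace)

text \<open>If the new letter meets its inverse, \<open>f_inverse\<close> removes the pair at the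
  given point. The converse inclusion can fail: \<open>[x, inv_letter x]\<close> is defined only on
  \<open>D x\<close>, its reduction everywhere.\<close>

lemma dom_act_reduce:
  "y \<in> act_dom w \<Longrightarrow> y \<in> act_dom (reduce w) \<and> act (reduce w) y = act w y"
proof (induction w)
  case (Cons x w)
  then have y: "y \<in> act_dom (reduce w)" "act (reduce w) y = act w y"
    "act w y \<in> D (inv_letter x)" by auto
  have r: "reduce (x # w) = push x (reduce w)" by (simp add: reduce_def)
  show ?case
  proof (cases "\<exists>v. reduce w = inv_letter x # v")
    case True
    then obtain v where v: "reduce w = inv_letter x # v" by blast
    then show ?thesis
      using y f_inverse[of "act v y" "inv_letter x"] by (auto simp: r)
  next
    case False
    then have "push x (reduce w) = x # reduce w" by (cases "reduce w") auto
    then show ?thesis using y by (simp add: r)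
  qed
qed (simp add: reduce_def)

lemma act_inv_word:
  "y \<in> act_dom w \<Longrightarrow> act w y \<in> act_dom (inv_word w) \<and> act (inv_word w) (act w y) = y"
proof (induction w)
  case (Cons x w)
  then have "act w y \<in> act_dom (inv_word w)" "act (inv_word w) (act w y) = y"
    "act w y \<in> D (inv_letter x)" by auto
  then show ?case
    using f_maps[of "act w y" x] f_inverse[of "act w y" x] D_subset
    by (auto simp: dom_append)
qed simp

text \<open>Openness and continuity need a joint induction: the next domain is the preimage of an
  open set under the previous map.\<close>

lemma openin_dom_continuous_act:
  "openin X (act_dom w) \<and> continuous_map (subtopology X (act_dom w)) X (act w)"
proof (induction w)
  case Nil
  then show ?case by (simp add: id_def[symmetric])
next
  case (Cons x w)
  have "openin (subtopology X (act_dom w))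
      {y \<in> topspace (subtopology X (act_dom w)). act w y \<in> D (inv_letter x)}"
    using Cons openin_D openin_continuous_map_preimage by blast
  moreover have "{y \<in> topspace (subtopology X (act_dom w)). act w y \<in> D (inv_letter x)} = act_dom (x # w)"
    using Cons by (auto dest: openin_subset)
  ultimately have op: "openin X (act_dom (x # w))"
    using Cons openin_trans_full by metis
  have "continuous_map (subtopology X (act_dom (x # w))) (subtopology X (D (inv_letter x))) (act w)"
    using Cons continuous_map_from_subtopology_mono[of X "act_dom w" X "act w" "act_dom (x # w)"]
    by (auto simp: continuous_map_in_subtopology)
  moreover have "continuous_map (subtopology X (D (inv_letter x))) X (f x)"
    using continuous_f[of x] by (simp add: continuous_map_in_subtopology)
  ultimately have "continuous_map (subtopology X (act_dom (x # w))) X (f x \<circ> act w)"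
    by (rule continuous_map_compose)
  then show ?case using op by (simp add: comp_def)
qed

lemma homeomorphic_map_act:
  "homeomorphic_map (subtopology X (act_dom w)) (subtopology X (act_dom (inv_word w))) (act w)"
proof -
  have "continuous_map (subtopology X (act_dom w)) (subtopology X (act_dom (inv_word w))) (act w)" for w
    using openin_dom_continuous_act[of w] act_inv_word[of _ w]
    by (auto simp: continuous_map_in_subtopology)
  from this[of w] this[of "inv_word w"]
  have "homeomorphic_maps (subtopology X (act_dom w)) (subtopology X (act_dom (inv_word w)))
      (act w) (act (inv_word w))"
    using act_inv_word[of _ w] act_inv_word[of _ "inv_word w"]
    by (simp add: homeomorphic_maps_def)
  then show ?thesis by (auto simp: homeomorphic_map_maps)
qed

lemma act_image_Int_subset:
  "act s ` (act_dom s \<inter> act_dom (inv_word t)) \<subseteq> act_dom (inv_word s) \<inter> act_dom (reduce (inv_word t @ inv_word s))"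
proof (rule image_subsetI)
  fix y assume y: "y \<in> act_dom s \<inter> act_dom (inv_word t)"
  then have "act s y \<in> act_dom (inv_word t @ inv_word s)"
    using act_inv_word[of y s] by (simp add: dom_append)
  then show "act s y \<in> act_dom (inv_word s) \<inter> act_dom (reduce (inv_word t @ inv_word s))"
    using dom_act_reduce act_inv_word y by blast
qed

text \<open>For the remaining inclusion the point is moved back along \<open>s\<close>. There the
  word for (t^-1 s^-1) s is defined, and it reduces to \<open>inv_word t\<close> because
  \<open>t\<close> is reduced.\<close>

lemma act_image_Int:
  assumes "reduced t"
  shows "act s ` (act_dom s \<inter> act_dom (inv_word t))
      = act_dom (inv_word s) \<inter> act_dom (reduce (inv_word t @ inv_word s))"
proof (rule antisym[OF act_image_Int_subset], rule subsetI)
  fix z assume z: "z \<in> act_dom (inv_word s) \<inter> act_dom (reduce (inv_word t @ inv_word s))"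
  define y where "y = act (inv_word s) z"
  have *: "reduce (reduce (inv_word t @ inv_word s) @ s) = inv_word t"
  proof -
    have "reduce (reduce (inv_word t @ inv_word s) @ s) = reduce (inv_word t @ inv_word s @ s)"
      by (simp add: reduce_reduce_left)
    also have "\<dots> = reduce (inv_word t @ reduce (inv_word s @ s))"
      by (simp add: reduce_reduce_right)
    also have "\<dots> = inv_word t"
      using reduced_inverse[OF assms] reduce_inverse[of s]
      by (simp add: inv_word_def reduce_reduced)
    finally show ?thesis .
  qed
  have y: "y \<in> act_dom s" "act s y = z"
    using act_inv_word[of z "inv_word s"] z by (auto simp: y_def)
  then have "y \<in> act_dom (reduce (inv_word t @ inv_word s) @ s)"
    using z by (simp add: dom_append)
  then have "y \<in> act_dom (inv_word t)"
    using dom_act_reduce * by metis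
  with y show "z \<in> act s ` (act_dom s \<inter> act_dom (inv_word t))" by auto
qed

text \<open>The inverse of a product in the free group, read on words; the group law replaces an
  induction over cancellations.\<close>

lemma inv_word_reduce_append:
  assumes "s \<in> carrier (free_group A)" "t \<in> carrier (free_group A)"
  shows "inv_word (reduce (s @ t)) = reduce (inv_word t @ inv_word s)"
proof -
  interpret F: group "free_group A" by (rule group_free_group)
  have "s \<otimes>\<^bsub>free_group A\<^esub> t \<in> carrier (free_group A)" using assms by simp
  then have "inv\<^bsub>free_group A\<^esub> (s \<otimes>\<^bsub>free_group A\<^esub> t) = inv_word (s \<otimes>\<^bsub>free_group A\<^esub> t)"
    by (simp add: inv_free_group inv_word_def)
  moreover have "inv\<^bsub>free_group A\<^esub> (s \<otimes>\<^bsub>free_group A\<^esub> t) =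
      inv\<^bsub>free_group A\<^esub> t \<otimes>\<^bsub>free_group A\<^esub> inv\<^bsub>free_group A\<^esub> s"
    using assms by (simp add: F.inv_mult_group)
  ultimately show ?thesis
    using assms by (simp add: inv_free_group inv_word_def) (simp add: free_group_def)
qed

text \<open>The point is only known to lie in the domains of \<open>t\<close> and of the reduced
  product, not of \<open>s @ t\<close>. Writing s as (st) t^-1 shows that \<open>act t y\<close>
  lies in the domain of \<open>s\<close>, which closes the gap.\<close>

lemma act_comp:
  assumes "s \<in> carrier (free_group A)" "t \<in> carrier (free_group A)"
    and y: "y \<in> act_dom t" "y \<in> act_dom (reduce (s @ t))"
  shows "act s (act t y) = act (reduce (s @ t)) y"
proof -
  let ?u = "inv_word (reduce (s @ t))"
  have red: "reduced s" "reduced t" using assms by (auto simp: free_group_def)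
  have "reduce (t @ ?u) = reduce (t @ inv_word t @ inv_word s)"
    using assms by (simp add: inv_word_reduce_append reduce_reduce_right)
  also have "\<dots> = reduce (reduce (t @ inv_word t) @ inv_word s)"
    by (simp add: reduce_reduce_left)
  also have "\<dots> = inv_word s"
    using reduce_inverse[of "inv_word t"] reduced_inverse[OF red(1)]
    by (simp add: inv_word_def[symmetric] reduce_reduced)
  finally have "reduce (reduce (s @ t) @ inv_word t) = s"
    using red reduce_inverse[of "inv_word t"]
    by (simp add: reduce_reduce_left reduce_reduced)
       (metis append_Nil2 inv_word_def inv_word_simps(3) reduce_reduce_right reduce_reduced)
  moreover have "act t y \<in> act_dom (reduce (s @ t) @ inv_word t)"
    using act_inv_word[OF y(1)] y(2) by (simp add: dom_append)
  ultimately have "act t y \<in> act_dom s" using dom_act_reduce by metis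
  then have "y \<in> act_dom (s @ t)" using y by (simp add: dom_append)
  then show ?thesis using dom_act_reduce[of y "s @ t"] by simp
qed

theorem partial_action_act:
  "partial_action (free_group A) X (\<lambda>t. act_dom (inv\<^bsub>free_group A\<^esub> t)) act"
proof (intro partial_action.intro partial_action_axioms.intro group_free_group)
  interpret F: group "free_group A" by (rule group_free_group)
  have inv: "inv\<^bsub>free_group A\<^esub> t = inv_word t" if "t \<in> carrier (free_group A)" for t
    using that by (simp add: inv_free_group inv_word_def)
  have mult: "s \<otimes>\<^bsub>free_group A\<^esub> t = reduce (s @ t)" for s t
    by (simp add: free_group_def)
  fix s t
  assume t: "t \<in> carrier (free_group A)"
  show "openin X (act_dom (inv\<^bsub>free_group A\<^esub> t))"
    using openin_dom_continuous_act by blast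
  show "homeomorphic_map (subtopology X (act_dom (inv\<^bsub>free_group A\<^esub> (inv\<^bsub>free_group A\<^esub> t))))
      (subtopology X (act_dom (inv\<^bsub>free_group A\<^esub> t))) (act t)"
    using homeomorphic_map_act[of t] by (simp only: F.inv_inv[OF t]) (simp only: inv[OF t])
  assume s: "s \<in> carrier (free_group A)"
  have st: "s \<otimes>\<^bsub>free_group A\<^esub> t \<in> carrier (free_group A)" using s t by simp
  show "act s ` (act_dom (inv\<^bsub>free_group A\<^esub> (inv\<^bsub>free_group A\<^esub> s)) \<inter> act_dom (inv\<^bsub>free_group A\<^esub> t))
      = act_dom (inv\<^bsub>free_group A\<^esub> s) \<inter> act_dom (inv\<^bsub>free_group A\<^esub> (s \<otimes>\<^bsub>free_group A\<^esub> t))"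
    using act_image_Int[of t s] t inv_word_reduce_append[OF s t]
    unfolding F.inv_inv[OF s] unfolding inv[OF s] inv[OF t] inv[OF st] unfolding mult
    by (simp add: free_group_def)
  fix y
  assume "y \<in> act_dom (inv\<^bsub>free_group A\<^esub> (inv\<^bsub>free_group A\<^esub> t)) \<inter>
      act_dom (inv\<^bsub>free_group A\<^esub> (inv\<^bsub>free_group A\<^esub> (s \<otimes>\<^bsub>free_group A\<^esub> t)))"
  then have "y \<in> act_dom t" "y \<in> act_dom (reduce (s @ t))"
    using st t by (auto simp: F.inv_inv mult)
  then show "act s (act t y) = act (s \<otimes>\<^bsub>free_group A\<^esub> t) y"
    using act_comp[OF s t] by (simp add: mult)
qed (auto simp: free_group_def inv_free_group[where x="[]" and A=A, unfolded free_group_def])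

text \<open>The length condition makes the product equal to \<open>s @ t\<close>, and then the claim
  is \<open>dom_append\<close>.\<close>

theorem semi_saturated_act: "semi_saturated A (\<lambda>t. act_dom (inv\<^bsub>free_group A\<^esub> t)) act"
  unfolding semi_saturated_def Let_def
proof (intro ballI impI)
  interpret F: group "free_group A" by (rule group_free_group)
  fix s t
  assume s: "s \<in> carrier (free_group A)" and t: "t \<in> carrier (free_group A)"
    and len: "length (s \<otimes>\<^bsub>free_group A\<^esub> t) = length s + length t"
  have st: "s \<otimes>\<^bsub>free_group A\<^esub> t \<in> carrier (free_group A)" using s t by simp
  have "s \<otimes>\<^bsub>free_group A\<^esub> t = s @ t"
    using len reduce_append_if_length[of t s] t by (simp add: free_group_def)
  then show "{x \<in> act_dom (inv\<^bsub>free_group A\<^esub> (inv\<^bsub>free_group A\<^esub> t)).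
        act t x \<in> act_dom (inv\<^bsub>free_group A\<^esub> (inv\<^bsub>free_group A\<^esub> s))}
      = act_dom (inv\<^bsub>free_group A\<^esub> (inv\<^bsub>free_group A\<^esub> (s \<otimes>\<^bsub>free_group A\<^esub> t))) \<and>
    (\<forall>x\<in>act_dom (inv\<^bsub>free_group A\<^esub> (inv\<^bsub>free_group A\<^esub> (s \<otimes>\<^bsub>free_group A\<^esub> t))).
      act s (act t x) = act (s \<otimes>\<^bsub>free_group A\<^esub> t) x)"
    using F.inv_inv[OF s] F.inv_inv[OF t] F.inv_inv[OF st] by (simp add: dom_append)
qed

end


section \<open>Words and their beginnings\<close>

lemma beginning_Nil [simp]: "beginning [] \<alpha>"
  by (cases \<alpha>) (auto simp: beginning_def)

lemma beginning_FinW: "beginning \<beta> (FinW xs) \<longleftrightarrow> prefix \<beta> xs"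
  unfolding beginning_def by (metis append_eq_conv_conj prefix_def take_is_prefix wtake.simps(1))

lemma beginning_InfW: "beginning \<beta> (InfW s) \<longleftrightarrow> stake (length \<beta>) s = \<beta>"
  by (simp add: beginning_def)

lemma beginning_wappend_single:
  "beginning \<gamma> (wappend [a] \<alpha>) \<longleftrightarrow> \<gamma> = [] \<or> (\<exists>\<beta>. \<gamma> = a # \<beta> \<and> beginning \<beta> \<alpha>)"
  by (cases \<gamma>; cases \<alpha>) (auto simp: beginning_def)

lemma beginning_wtake_1: "\<alpha> \<noteq> FinW [] \<Longrightarrow> \<exists>b. wtake 1 \<alpha> = [b] \<and> beginning [b] \<alpha>"
proof (cases \<alpha>)
  case (FinW xs)
  then show "\<alpha> \<noteq> FinW [] \<Longrightarrow> ?thesis" by (cases xs) (auto simp: beginning_def)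
qed (auto simp: beginning_def)

lemma wappend_wdrop_1: "beginning [a] \<alpha> \<Longrightarrow> wappend [a] (wdrop 1 \<alpha>) = \<alpha>"
proof (cases \<alpha>)
  case (FinW xs)
  then show "beginning [a] \<alpha> \<Longrightarrow> ?thesis" by (cases xs) (auto simp: beginning_def)
next
  case (InfW s)
  then show "beginning [a] \<alpha> \<Longrightarrow> ?thesis" by (cases s) (auto simp: beginning_def)
qed

lemma word_eqI:
  assumes "{\<beta>. beginning \<beta> \<alpha>} = {\<beta>. beginning \<beta> \<alpha>'}"
  shows "\<alpha> = \<alpha>'"
proof -
  have iff: "beginning \<beta> \<alpha> \<longleftrightarrow> beginning \<beta> \<alpha>'" for \<beta> using assms by blast
  have no: False if "\<And>\<beta>. beginning \<beta> (FinW xs) \<longleftrightarrow> beginning \<beta> (InfW s)" for xs :: "'a list" and s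
  proof -
    have "beginning (stake (Suc (length xs)) s) (InfW s)"
      unfolding beginning_InfW length_stake ..
    then have "prefix (stake (Suc (length xs)) s) xs"
      using that beginning_FinW by blast
    then show False using prefix_length_le by fastforce
  qed
  show ?thesis
  proof (cases \<alpha>)
    case F: (FinW xs)
    show ?thesis
    proof (cases \<alpha>')
      case (FinW ys)
      then show ?thesis
        using F iff[of xs] iff[of ys] by (auto simp: beginning_FinW intro: prefix_order.antisym)
    next
      case (InfW s)
      then show ?thesis using F iff no[of xs s] by blast
    qed
  next
    case F: (InfW s)
    show ?thesis
    proof (cases \<alpha>')
      case (FinW ys)
      then show ?thesis using F iff no[of ys s] by blast
    next
      case (InfW s')
      have "stake n s = stake n s'" for n
        using iff[of "stake n s"] by (simp add: F InfW beginning_InfW)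
      then have "s !! n = s' !! n" for n
        by (metis lessI stake_nth)
      then have "smap id s = smap id s'"
        by (simp only: smap_alt) simp
      then show ?thesis by (simp add: F InfW stream.map_id)
    qed
  qed
qed

text \<open>This makes the definite description in \<open>word_of\<close> meaningful. If lengths in
  \<open>W\<close> are bounded, a longest element is the word; otherwise \<open>W\<close> has
  exactly one element of each length, and these fit together to a stream.\<close>

lemma ex1_word:
  assumes Nil: "[] \<in> W" and pre: "\<And>u v. \<lbrakk>v \<in> W; prefix u v\<rbrakk> \<Longrightarrow> u \<in> W"
    and chain: "\<And>u v. \<lbrakk>u \<in> W; v \<in> W\<rbrakk> \<Longrightarrow> prefix u v \<or> prefix v u"
  shows "\<exists>!\<alpha>. {\<beta>. beginning \<beta> \<alpha>} = W"
proof -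
  have "\<exists>\<alpha>. {\<beta>. beginning \<beta> \<alpha>} = W"
  proof (cases "\<exists>w\<in>W. \<forall>v\<in>W. length v \<le> length w")
    case True
    then obtain w where w: "w \<in> W" "\<And>v. v \<in> W \<Longrightarrow> length v \<le> length w" by blast
    have "v \<in> W \<longleftrightarrow> prefix v w" for v
      using w pre chain[of v w] by (metis prefix_length_prefix prefix_order.refl)
    then show ?thesis by (intro exI[of _ "FinW w"]) (auto simp: beginning_FinW)
  next
    case False
    have "\<exists>v\<in>W. length v = n" for n
    proof (induction n)
      case (Suc n)
      then obtain u where u: "u \<in> W" "length u = n" by blast
      with False obtain v where v: "v \<in> W" "n < length v" by (auto simp: not_le)
      then have "take (Suc n) v \<in> W" using pre take_is_prefix by blast
      with v show ?case by (intro bexI[of _ "take (Suc n) v"]) auto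
    qed (use Nil in auto)
    then obtain w where w: "w n \<in> W" "length (w n) = n" for n by metis
    have eq: "v = w (length v)" if "v \<in> W" for v
      using chain[OF that w(1)[of "length v"]] w(2)[of "length v"]
      by (metis append_Nil2 append_eq_append_conv prefix_def)
    \<comment> \<open>Entry \<open>n\<close> is the last letter of \<open>w (Suc n)\<close>, the
      shortest element of \<open>W\<close> that has a position \<open>n\<close>.\<close>
    define s where "s = smap (\<lambda>n. w (Suc n) ! n) nats"
    have "stake n s = w n" for n
    proof (rule nth_equalityI)
      fix i assume "i < length (stake n s)"
      then have i: "i < n" by simp
      then have "take (Suc i) (w n) = w (Suc i)"
        using eq[of "take (Suc i) (w n)"] pre[OF w(1) take_is_prefix] w(2)[of n] by simp
      then show "stake n s ! i = w n ! i"
        using i by (simp add: s_def) (metis lessI nth_take)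
    qed (simp add: w)
    then have "{\<beta>. beginning \<beta> (InfW s)} = W"
      using eq w(1) by (auto simp: beginning_InfW) metis
    then show ?thesis by blast
  qed
  then show ?thesis using word_eqI by blast
qed


section \<open>Relative ranges\<close>

context labelled_graph
begin

lemma rel_range_Nil [simp]: "rel_range A [] = A"
  by (simp add: rel_range_def)

lemma rng_Nil: "rng [] = verts \<E>"
  by (simp add: rng_def)

lemma rel_range_append: "rel_range A (\<alpha> @ \<beta>) = rel_range (rel_range A \<alpha>) \<beta>"
\<comment> \<open>\<open>rel_range A []\<close> is \<open>A\<close> even when \<open>A\<close> is
  not a set of vertices, whereas empty walks exist only at vertices.\<close>
proof (cases "\<alpha> = [] \<or> \<beta> = []")
  case False
  then show ?thesis
    by (auto simp: rel_range_def awalk_append_iff map_eq_append_conv) (metis awalk_appendI)+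
qed auto

lemma rng_append: "rng (\<alpha> @ \<beta>) = rel_range (rng \<alpha>) \<beta>"
  by (simp add: rng_def rel_range_append)

lemma rng_Cons: "rng (a # \<beta>) = rel_range (rng [a]) \<beta>"
  using rng_append[of "[a]" \<beta>] by simp

lemma rel_range_Cons: "rel_range A (a # \<beta>) = rel_range (rel_range A [a]) \<beta>"
  using rel_range_append[of A "[a]" \<beta>] by simp

lemma rel_range_mono: "A \<subseteq> B \<Longrightarrow> rel_range A \<alpha> \<subseteq> rel_range B \<alpha>"
  by (auto simp: rel_range_def)

lemma rel_range_empty [simp]: "rel_range {} \<alpha> = {}"
  by (simp add: rel_range_def)

lemma rel_range_subset_rng: "A \<subseteq> verts \<E> \<Longrightarrow> rel_range A \<alpha> \<subseteq> rng \<alpha>"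
  unfolding rng_def by (rule rel_range_mono)

lemma rng_subset_verts: "rng \<alpha> \<subseteq> verts \<E>"
  by (auto simp: rng_def rel_range_def)

text \<open>A range is non-empty exactly when some path carries the word; for the empty word this is
  non-emptiness of the vertex set.\<close>

lemma labels_iff: "\<alpha> \<in> labels \<longleftrightarrow> rng \<alpha> \<noteq> {}"
  using verts_nonempty
  by (auto simp: labels_def labels1_def rng_def rel_range_def)

lemma labels1_iff: "\<alpha> \<in> labels1 \<longleftrightarrow> \<alpha> \<noteq> [] \<and> rng \<alpha> \<noteq> {}"
  unfolding labels1_def rng_def rel_range_def by (auto dest: awalk_hd_in_verts)

lemma labels_appendD:
  assumes "\<alpha> @ \<beta> \<in> labels"
  shows "\<alpha> \<in> labels" "\<beta> \<in> labels"
  using assms rel_range_subset_rng[OF rng_subset_verts, of \<alpha> \<beta>]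
  by (auto simp: labels_iff rng_append)

end


section \<open>Filters\<close>

context labelled_space
begin

lemma \<B>_at_Nil [simp]: "\<B>_at [] = \<B>"
  using \<B>_subset by (auto simp: \<B>_at_def rng_Nil)

lemma \<B>_atD: "A \<in> \<B>_at \<alpha> \<Longrightarrow> A \<in> \<B>" "A \<in> \<B>_at \<alpha> \<Longrightarrow> A \<subseteq> rng \<alpha>"
  by (auto simp: \<B>_at_def)

lemma Idm_in_ES_iff: "Idm \<alpha> A \<in> ES \<longleftrightarrow> A \<noteq> {} \<and> A \<in> \<B>_at \<alpha>"
  by (auto simp: ES_def labels_iff \<B>_at_def)

lemma ES_cases:
  assumes "x \<in> ES" "x \<noteq> Zero"
  obtains \<alpha> A where "x = Idm \<alpha> A" "A \<noteq> {}" "A \<in> \<B>_at \<alpha>"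
  using assms by (cases x) (auto simp: Idm_in_ES_iff)

lemma ES_labels: "Idm \<alpha> A \<in> ES \<Longrightarrow> \<alpha> \<in> labels"
  by (auto simp: ES_def)

lemma ES_le_Idm_iff:
  "ES_le (Idm \<alpha> A) y \<longleftrightarrow> (\<exists>\<beta> \<alpha>' B. y = Idm \<beta> B \<and> \<alpha> = \<beta> @ \<alpha>' \<and> A \<subseteq> rel_range B \<alpha>')"
  by (cases y) auto

text \<open>For \<open>\<alpha> = []\<close> the range is the whole vertex set, perhaps not in \<B>,
  but intersecting with it changes nothing.\<close>

lemma rng_Int_\<B>_at: "C \<in> \<B>_at \<beta> \<Longrightarrow> \<alpha> \<in> labels \<Longrightarrow> C \<inter> rng \<alpha> \<in> \<B>_at \<alpha>"
  using \<B>_Int[of C "rng \<alpha>"] \<B>_rng[of \<alpha>]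
  by (cases "\<alpha> = []") (auto simp: \<B>_at_def labels_def rng_Nil Int_absorb2 \<B>_subset)

lemma rel_range_\<B>_at:
  assumes "A \<in> \<B>_at \<alpha>" "\<beta> \<in> labels"
  shows "rel_range A \<beta> \<in> \<B>_at (\<alpha> @ \<beta>)"
  using assms \<B>_rel_range rel_range_mono[of A "rng \<alpha>" \<beta>] by (auto simp: \<B>_at_def rng_append)

lemma ES_le_trans: "ES_le u v \<Longrightarrow> ES_le v w \<Longrightarrow> ES_le u w"
  using rel_range_mono by (cases u; cases v; cases w) (auto simp: rel_range_append, blast)

lemma filter_in_ES: "is_filter \<xi> \<Longrightarrow> x \<in> \<xi> \<Longrightarrow> x \<in> ES"
  by (auto simp: is_filter_def)

lemma filter_up: "\<lbrakk>is_filter \<xi>; x \<in> \<xi>; y \<in> ES; ES_le x y\<rbrakk> \<Longrightarrow> y \<in> \<xi>"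
  by (auto simp: is_filter_def)

lemma filter_lower_bound:
  "\<lbrakk>is_filter \<xi>; x \<in> \<xi>; y \<in> \<xi>\<rbrakk> \<Longrightarrow> \<exists>z\<in>\<xi>. ES_le z x \<and> ES_le z y"
  unfolding is_filter_def is_meet_def by blast

lemma filter_Idm_cases:
  assumes "is_filter \<xi>" "x \<in> \<xi>"
  obtains \<alpha> A where "x = Idm \<alpha> A" "A \<noteq> {}" "A \<in> \<B>_at \<alpha>"
  using assms by (metis ES_cases is_filter_def subsetD)

lemma filter_chain:
  assumes "is_filter \<xi>" "Idm \<alpha> A \<in> \<xi>" "Idm \<beta> B \<in> \<xi>"
  shows "prefix \<alpha> \<beta> \<or> prefix \<beta> \<alpha>"
proof -
  obtain z where "z \<in> \<xi>" "ES_le z (Idm \<alpha> A)" "ES_le z (Idm \<beta> B)"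
    using filter_lower_bound assms by blast
  then obtain \<gamma> where "prefix \<alpha> \<gamma>" "prefix \<beta> \<gamma>"
    using assms(1) by (metis filter_Idm_cases ES_le.simps(3) prefixI)
  then show ?thesis using prefix_same_cases by blast
qed

lemma word_of:
  assumes "is_filter \<xi>"
  shows "beginning \<beta> (word_of \<xi>) \<longleftrightarrow> \<beta> = [] \<or> (\<exists>A. Idm \<beta> A \<in> \<xi>)"
proof -
  have "\<exists>!\<alpha>. {\<beta>. beginning \<beta> \<alpha>} = insert [] {\<beta>. \<exists>A. Idm \<beta> A \<in> \<xi>}"
  proof (rule ex1_word)
    fix u v assume v: "v \<in> insert [] {\<beta>. \<exists>A. Idm \<beta> A \<in> \<xi>}" and pre: "prefix u v"
    show "u \<in> insert [] {\<beta>. \<exists>A. Idm \<beta> A \<in> \<xi>}"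
    proof (cases "u = []")
      \<comment> \<open>For non-empty \<open>u\<close> the set \<open>rng u\<close> belongs to \<B>,
        so \<open>Idm u (rng u)\<close> is an idempotent above \<open>Idm v A\<close>. At
        \<open>u = []\<close> such an idempotent may be missing.\<close>
      case False
      then obtain A w where A: "Idm v A \<in> \<xi>" and w: "v = u @ w"
        using v pre by (auto simp: prefix_def)
      have *: "A \<noteq> {}" "A \<in> \<B>_at v" using filter_in_ES[OF assms A] by (auto simp: Idm_in_ES_iff)
      then have sub: "A \<subseteq> rel_range (rng u) w" by (auto simp: \<B>_at_def w rng_append)
      then have "rng u \<noteq> {}" using * by auto
      then have "Idm u (rng u) \<in> ES"
        using False \<B>_rng labels1_iff by (auto simp: Idm_in_ES_iff \<B>_at_def)
      then have "Idm u (rng u) \<in> \<xi>" using filter_up[OF assms A] sub w by auto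
      then show ?thesis by blast
    qed simp
  qed (use filter_chain[OF assms] in auto)
  then have "{\<beta>. beginning \<beta> (word_of \<xi>)} = insert [] {\<beta>. \<exists>A. Idm \<beta> A \<in> \<xi>}"
    unfolding word_of_def by (rule theI')
  then show ?thesis by blast
qed

end

context normal_labelled_space
begin

lemma rel_range_Int:
  "\<lbrakk>A \<in> \<B>; B \<in> \<B>; \<alpha> \<in> labels\<rbrakk> \<Longrightarrow> rel_range (A \<inter> B) \<alpha> = rel_range A \<alpha> \<inter> rel_range B \<alpha>"
  using wlr by (auto simp: weakly_left_resolving_def labels_def)

text \<open>A common lower bound with word \<open>\<alpha> @ \<beta> @ \<delta>\<close> lies in two
  ranges along \<open>\<delta>\<close>, and weak left-resolving turns their intersection into the
  range of the intersection. The non-zero bound \<open>w\<close> guarantees that the proposed meet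
  is not the empty set.\<close>

lemma is_meet_prefix:
  assumes A: "Idm \<alpha> A \<in> ES" and B: "Idm (\<alpha> @ \<beta>) B \<in> ES"
    and w: "w \<in> ES" "w \<noteq> Zero" "ES_le w (Idm \<alpha> A)" "ES_le w (Idm (\<alpha> @ \<beta>) B)"
  shows "is_meet (Idm \<alpha> A) (Idm (\<alpha> @ \<beta>) B) (Idm (\<alpha> @ \<beta>) (rel_range A \<beta> \<inter> B))"
proof -
  let ?M = "rel_range A \<beta> \<inter> B"
  have lab: "\<alpha> @ \<beta> \<in> labels" using B by (rule ES_labels)
  have rA: "rel_range A \<beta> \<in> \<B>" using A \<B>_rel_range labels_appendD[OF lab]
    by (auto simp: Idm_in_ES_iff \<B>_at_def)
  have Bs: "B \<in> \<B>" "B \<subseteq> rng (\<alpha> @ \<beta>)" using B by (auto simp: Idm_in_ES_iff \<B>_at_def)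
  have low: "ES_le v (Idm (\<alpha> @ \<beta>) ?M)"
    if v: "v \<in> ES" "v \<noteq> Zero" "ES_le v (Idm \<alpha> A)" "ES_le v (Idm (\<alpha> @ \<beta>) B)" for v
  proof -
    obtain \<delta> C where C: "v = Idm (\<alpha> @ \<beta> @ \<delta>) C" "C \<subseteq> rel_range B \<delta>" "C \<subseteq> rel_range A (\<beta> @ \<delta>)"
      using v by (cases v) auto
    then have "\<delta> \<in> labels" using v(1) ES_labels labels_appendD(2)[of "\<alpha> @ \<beta>" \<delta>] by simp
    then have "C \<subseteq> rel_range ?M \<delta>"
      using C rel_range_Int[OF rA Bs(1)] by (auto simp: rel_range_append)
    then show ?thesis using C by simp
  qed
  have "?M \<noteq> {}"
    using low[OF w] w by (cases w) (auto simp: Idm_in_ES_iff)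
  then have "Idm (\<alpha> @ \<beta>) ?M \<in> ES"
    using \<B>_Int[OF rA Bs(1)] Bs(2) by (auto simp: Idm_in_ES_iff \<B>_at_def)
  moreover have "ES_le v (Idm (\<alpha> @ \<beta>) ?M)"
    if "v \<in> ES" "ES_le v (Idm \<alpha> A)" "ES_le v (Idm (\<alpha> @ \<beta>) B)" for v
    using low that by (cases "v = Zero") auto
  ultimately show ?thesis by (auto simp: is_meet_def)
qed

lemma is_meet_commute: "is_meet x y z \<longleftrightarrow> is_meet y x z"
  by (auto simp: is_meet_def)

lemma ex_meet:
  assumes "x \<in> ES" "y \<in> ES" "w \<in> ES" "w \<noteq> Zero" "ES_le w x" "ES_le w y"
  shows "\<exists>z. is_meet x y z"
proof -
  obtain \<gamma> C where w: "w = Idm \<gamma> C" using assms by (cases w) auto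
  obtain \<alpha> A where x: "x = Idm \<alpha> A" using assms w by (cases x) auto
  obtain \<beta> B where y: "y = Idm \<beta> B" using assms w by (cases y) auto
  have "prefix \<alpha> \<gamma>" "prefix \<beta> \<gamma>" using assms(5,6) w x y by (metis ES_le.simps(3) prefixI)+
  then consider "prefix \<alpha> \<beta>" | "prefix \<beta> \<alpha>" using prefix_same_cases by blast
  then show ?thesis
  proof cases
    case 1
    then obtain \<delta> where "\<beta> = \<alpha> @ \<delta>" by (auto simp: prefix_def)
    then have "is_meet x y (Idm (\<alpha> @ \<delta>) (rel_range A \<delta> \<inter> B))"
      using is_meet_prefix[of \<alpha> A \<delta> B w] assms x y by simp
    then show ?thesis by blast
  next
    case 2
    then obtain \<delta> where "\<alpha> = \<beta> @ \<delta>" by (auto simp: prefix_def)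
    then have "is_meet y x (Idm (\<beta> @ \<delta>) (rel_range B \<delta> \<inter> A))"
      using is_meet_prefix[of \<beta> B \<delta> A w] assms x y by simp
    then show ?thesis using is_meet_commute by blast
  qed
qed

text \<open>Meets need not be computed: a common lower bound in \<open>\<xi>\<close> is non-zero, so
  the meet exists, lies above that bound and belongs to \<open>\<xi>\<close> by upward
  closure.\<close>

lemma is_filterI:
  assumes sub: "\<xi> \<subseteq> ES" and ne: "\<xi> \<noteq> {}" and Zero: "Zero \<notin> \<xi>"
    and up: "\<And>x y. \<lbrakk>x \<in> \<xi>; y \<in> ES; ES_le x y\<rbrakk> \<Longrightarrow> y \<in> \<xi>"
    and down: "\<And>x y. \<lbrakk>x \<in> \<xi>; y \<in> \<xi>\<rbrakk> \<Longrightarrow> \<exists>z\<in>\<xi>. ES_le z x \<and> ES_le z y"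
  shows "is_filter \<xi>"
proof -
  have "\<exists>z\<in>\<xi>. is_meet x y z" if xy: "x \<in> \<xi>" "y \<in> \<xi>" for x y
  proof -
    obtain w where w: "w \<in> \<xi>" "ES_le w x" "ES_le w y" using down[OF xy] by blast
    then obtain z where "is_meet x y z" using ex_meet[of x y w] xy sub Zero by blast
    moreover from this have "z \<in> \<xi>" using up[OF w(1)] w sub by (auto simp: is_meet_def)
    ultimately show ?thesis by blast
  qed
  then show ?thesis using assms unfolding is_filter_def by blast
qed

lemma filter_Int_rel_range:
  assumes \<xi>: "is_filter \<xi>" and A: "Idm \<alpha> A \<in> \<xi>" and B: "Idm (\<alpha> @ \<beta>) B \<in> \<xi>"
  shows "Idm (\<alpha> @ \<beta>) (rel_range A \<beta> \<inter> B) \<in> \<xi>"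
proof -
  obtain w where w: "w \<in> \<xi>" "ES_le w (Idm \<alpha> A)" "ES_le w (Idm (\<alpha> @ \<beta>) B)"
    using filter_lower_bound[OF \<xi> A B] by blast
  have "w \<in> ES" "w \<noteq> Zero" using w \<xi> by (auto simp: is_filter_def)
  then have "is_meet (Idm \<alpha> A) (Idm (\<alpha> @ \<beta>) B) (Idm (\<alpha> @ \<beta>) (rel_range A \<beta> \<inter> B))"
    using is_meet_prefix filter_in_ES[OF \<xi>] A B w by blast
  then show ?thesis
    using filter_up[OF \<xi> w(1)] w \<open>w \<in> ES\<close> by (auto simp: is_meet_def)
qed

text \<open>Once the filter reaches \<open>\<alpha> @ \<beta>\<close>, its level at
  \<open>\<alpha>\<close> is the pullback of the later level. \<open>B\<close> witnesses that it
  does: intersecting with \<open>B\<close> gives the member from which upward closure yields the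
  range of \<open>D\<close>.\<close>

lemma filter_rel_range_iff:
  assumes \<xi>: "is_filter \<xi>" and B: "Idm (\<alpha> @ \<beta>) B \<in> \<xi>" and D: "D \<in> \<B>_at \<alpha>"
  shows "Idm \<alpha> D \<in> \<xi> \<longleftrightarrow> Idm (\<alpha> @ \<beta>) (rel_range D \<beta>) \<in> \<xi>"
proof
  assume "Idm \<alpha> D \<in> \<xi>"
  then have *: "Idm (\<alpha> @ \<beta>) (rel_range D \<beta> \<inter> B) \<in> \<xi>" using filter_Int_rel_range[OF \<xi>] B by blast
  then have "rel_range D \<beta> \<noteq> {}" using filter_in_ES[OF \<xi>] by (fastforce simp: Idm_in_ES_iff)
  moreover have "\<beta> \<in> labels" using filter_in_ES[OF \<xi> B] ES_labels labels_appendD by blast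
  ultimately have "Idm (\<alpha> @ \<beta>) (rel_range D \<beta>) \<in> ES"
    using rel_range_\<B>_at[OF D] by (simp add: Idm_in_ES_iff)
  then show "Idm (\<alpha> @ \<beta>) (rel_range D \<beta>) \<in> \<xi>" using filter_up[OF \<xi> *] by simp
next
  assume *: "Idm (\<alpha> @ \<beta>) (rel_range D \<beta>) \<in> \<xi>"
  then have "D \<noteq> {}" using filter_in_ES[OF \<xi> *] by (auto simp: Idm_in_ES_iff)
  then show "Idm \<alpha> D \<in> \<xi>" using filter_up[OF \<xi> *] D by (simp add: Idm_in_ES_iff)
qed

end


section \<open>Conjugation by a letter\<close>

context labelled_space
begin

text \<open>
  In the inverse semigroup of the labelled space, \<open>stretch a \<xi>\<close> is the upward closure of
  \<open>s \<xi> s*\<close> and \<open>shrink a \<eta>\<close> is the upward closure of \<open>s* \<eta> s\<close>, where \<open>s = (a, r(a), \<omega>)\<close>.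
\<close>

definition stretch :: "'a \<Rightarrow> ('a, 'v) idem set \<Rightarrow> ('a, 'v) idem set" where
  "stretch a \<xi> = {Idm (a # \<beta>) A | \<beta> A. A \<in> \<B>_at (a # \<beta>) \<and> Idm \<beta> A \<in> \<xi>} \<union>
     {Idm [] A | A. A \<in> \<B> \<and> Idm [] (rel_range A [a]) \<in> \<xi>}"

definition shrink :: "'a \<Rightarrow> ('a, 'v) idem set \<Rightarrow> ('a, 'v) idem set" where
  "shrink a \<eta> = {Idm \<beta> C | \<beta> C. Idm \<beta> C \<in> ES \<and> Idm (a # \<beta>) (C \<inter> rng (a # \<beta>)) \<in> \<eta>}"

lemma Idm_Cons_in_stretch_iff:
  "Idm (b # \<beta>) A \<in> stretch a \<xi> \<longleftrightarrow> b = a \<and> A \<in> \<B>_at (a # \<beta>) \<and> Idm \<beta> A \<in> \<xi>"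
  by (auto simp: stretch_def)

lemma Idm_Nil_in_stretch_iff:
  "Idm [] A \<in> stretch a \<xi> \<longleftrightarrow> A \<in> \<B> \<and> Idm [] (rel_range A [a]) \<in> \<xi>"
  by (auto simp: stretch_def)

lemma Zero_notin [simp]: "Zero \<notin> stretch a \<xi>" "Zero \<notin> shrink a \<eta>"
  by (auto simp: stretch_def shrink_def)

lemma Idm_in_shrink_iff:
  "Idm \<beta> C \<in> shrink a \<eta> \<longleftrightarrow> Idm \<beta> C \<in> ES \<and> Idm (a # \<beta>) (C \<inter> rng (a # \<beta>)) \<in> \<eta>"
  by (auto simp: shrink_def)

lemmas stretch_iffs = Idm_Cons_in_stretch_iff Idm_Nil_in_stretch_iff

end

context normal_labelled_space
begin

text \<open>This is the meet with \<open>Idm [] (rng [a])\<close>: every member can be shrunk to one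
  whose word may be prefixed by \<open>a\<close>.\<close>

lemma filter_Int_rng_Cons:
  assumes "is_filter \<xi>" "Idm [] (rng [a]) \<in> \<xi>" "Idm \<beta> C \<in> \<xi>"
  shows "Idm \<beta> (C \<inter> rng (a # \<beta>)) \<in> \<xi>" "C \<inter> rng (a # \<beta>) \<in> \<B>_at (a # \<beta>)"
proof -
  show *: "Idm \<beta> (C \<inter> rng (a # \<beta>)) \<in> \<xi>"
    using filter_Int_rel_range[of \<xi> "[]" "rng [a]" \<beta> C] assms
    by (simp add: Int_commute flip: rng_Cons)
  then have "rng (a # \<beta>) \<noteq> {}" "C \<in> \<B>_at \<beta>"
    using filter_in_ES[OF assms(1) *] filter_in_ES[OF assms(1,3)] by (auto simp: Idm_in_ES_iff)
  then show "C \<inter> rng (a # \<beta>) \<in> \<B>_at (a # \<beta>)"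
    using rng_Int_\<B>_at by (simp add: labels_iff)
qed

lemma rng_Cons_subset: "rng (a # \<beta>) \<subseteq> rng \<beta>"
  using rel_range_subset_rng[OF rng_subset_verts, of "[a]" \<beta>] by (simp flip: rng_Cons)

lemma \<B>_at_ConsD: "A \<in> \<B>_at (a # \<beta>) \<Longrightarrow> A \<in> \<B>_at \<beta>"
  using rng_Cons_subset by (auto simp: \<B>_at_def)

lemma Int_rng_eq: "A \<in> \<B>_at \<alpha> \<Longrightarrow> A \<inter> rng \<alpha> = A"
  by (auto simp: \<B>_at_def)

lemma filter_Cons_rel_range_iff:
  assumes "is_filter \<eta>" "Idm [a] (rng [a]) \<in> \<eta>" "D \<in> \<B>"
  shows "Idm [] D \<in> \<eta> \<longleftrightarrow> Idm [a] (rel_range D [a]) \<in> \<eta>"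
  using filter_rel_range_iff[of \<eta> "[]" "[a]" "rng [a]" D] assms by simp

lemma rel_range_single_\<B>_at:
  assumes "rel_range D [a] \<noteq> {}" "D \<in> \<B>"
  shows "rel_range D [a] \<in> \<B>_at [a]"
proof -
  have "rel_range D [a] \<subseteq> rng [a]" by (rule rel_range_subset_rng[OF \<B>_subset[OF assms(2)]])
  then have "[a] \<in> labels" using assms(1) by (auto simp: labels_iff)
  then show ?thesis using rel_range_\<B>_at[of D "[]" "[a]"] assms by simp
qed

text \<open>Below a member \<open>Idm [] A\<close> lies \<open>Idm [a] (rel_range A [a])\<close>, so
  lower bounds and upward closure need only be studied from members whose word begins with
  \<open>a\<close>.\<close>

lemma stretch_below:
  assumes \<xi>: "is_filter \<xi>" and x: "x \<in> stretch a \<xi>"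
  obtains \<beta> A where "Idm \<beta> A \<in> \<xi>" "A \<in> \<B>_at (a # \<beta>)" "ES_le (Idm (a # \<beta>) A) x"
proof (cases x)
  case Zero
  then show thesis using x by simp
next
  case (Idm \<gamma> A)
  show thesis
  proof (cases \<gamma>)
    case Nil
    then have *: "A \<in> \<B>" "Idm [] (rel_range A [a]) \<in> \<xi>"
      using x Idm by (auto simp: Idm_Nil_in_stretch_iff)
    then have "rel_range A [a] \<noteq> {}" using filter_in_ES[OF \<xi>] Idm_in_ES_iff by blast
    then have "rel_range A [a] \<in> \<B>_at [a]" using * rel_range_single_\<B>_at by blast
    then show thesis using that[of "[]" "rel_range A [a]"] * Idm Nil by simp
  next
    case (Cons b \<beta>)
    then have "Idm \<beta> A \<in> \<xi>" "A \<in> \<B>_at (a # \<beta>)" "x = Idm (a # \<beta>) A"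
      using x Idm by (simp_all add: Idm_Cons_in_stretch_iff)
    then show thesis using that by simp
  qed
qed

lemma is_filter_stretch:
  assumes \<xi>: "is_filter \<xi>" and a: "Idm [] (rng [a]) \<in> \<xi>"
  shows "is_filter (stretch a \<xi>)"
proof (rule is_filterI)
  show "stretch a \<xi> \<subseteq> ES"
  proof
    fix x assume x: "x \<in> stretch a \<xi>"
    show "x \<in> ES"
    proof (cases x)
      case (Idm \<gamma> A)
      show ?thesis
      proof (cases \<gamma>)
        case Nil
        then have "A \<in> \<B>" "Idm [] (rel_range A [a]) \<in> ES"
          using x Idm filter_in_ES[OF \<xi>] by (auto simp: Idm_Nil_in_stretch_iff)
        then show ?thesis using Idm Nil by (auto simp: Idm_in_ES_iff)
      next
        case (Cons b \<beta>)
        then have "A \<in> \<B>_at \<gamma>" "Idm \<beta> A \<in> ES"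
          using x Idm filter_in_ES[OF \<xi>] by (auto simp: Idm_Cons_in_stretch_iff)
        then show ?thesis using Idm by (auto simp: Idm_in_ES_iff)
      qed
    qed (simp add: ES_def)
  qed
  show "stretch a \<xi> \<noteq> {}"
    using filter_Int_rng_Cons[OF \<xi> a a] a by (auto simp: stretch_def)
  show "y \<in> stretch a \<xi>" if x: "x \<in> stretch a \<xi>" and y: "y \<in> ES" and le: "ES_le x y" for x y
  proof -
    obtain \<beta> A where A: "Idm \<beta> A \<in> \<xi>" "A \<in> \<B>_at (a # \<beta>)" and "ES_le (Idm (a # \<beta>) A) x"
      using stretch_below[OF \<xi> x] .
    then have "ES_le (Idm (a # \<beta>) A) y" using le ES_le_trans by blast
    then obtain \<gamma> \<delta> B where yB: "y = Idm \<gamma> B" "a # \<beta> = \<gamma> @ \<delta>" "A \<subseteq> rel_range B \<delta>"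
      by (auto simp: ES_le_Idm_iff)
    have B: "B \<in> \<B>_at \<gamma>" "B \<noteq> {}" using y yB by (auto simp: Idm_in_ES_iff)
    show ?thesis
    proof (cases \<gamma>)
      case Nil
      then have sub: "A \<subseteq> rel_range (rel_range B [a]) \<beta>" using yB by (simp flip: rel_range_Cons)
      moreover have "A \<noteq> {}" using filter_in_ES[OF \<xi> A(1)] by (simp add: Idm_in_ES_iff)
      ultimately have "rel_range B [a] \<noteq> {}" by auto
      then have "Idm [] (rel_range B [a]) \<in> ES"
        using \<B>_atD(1)[OF rel_range_single_\<B>_at, of B a] B Nil by (simp add: Idm_in_ES_iff)
      then have "Idm [] (rel_range B [a]) \<in> \<xi>" using filter_up[OF \<xi> A(1)] sub by simp
      then show ?thesis using B Nil yB by (simp add: Idm_Nil_in_stretch_iff)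
    next
      case (Cons b \<gamma>')
      then have "Idm \<gamma>' B \<in> ES" using B yB \<B>_at_ConsD by (auto simp: Idm_in_ES_iff)
      then have "Idm \<gamma>' B \<in> \<xi>" using filter_up[OF \<xi> A(1)] yB Cons by simp
      then show ?thesis using B Cons yB by (simp add: Idm_Cons_in_stretch_iff)
    qed
  qed
  show "\<exists>z\<in>stretch a \<xi>. ES_le z x \<and> ES_le z y"
    if x: "x \<in> stretch a \<xi>" and y: "y \<in> stretch a \<xi>" for x y
  proof -
    obtain \<beta> A where A: "Idm \<beta> A \<in> \<xi>" "A \<in> \<B>_at (a # \<beta>)" "ES_le (Idm (a # \<beta>) A) x"
      using stretch_below[OF \<xi> x] .
    obtain \<gamma> B where B: "Idm \<gamma> B \<in> \<xi>" "B \<in> \<B>_at (a # \<gamma>)" "ES_le (Idm (a # \<gamma>) B) y"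
      using stretch_below[OF \<xi> y] .
    obtain z where z: "z \<in> \<xi>" "ES_le z (Idm \<beta> A)" "ES_le z (Idm \<gamma> B)"
      using filter_lower_bound[OF \<xi> A(1) B(1)] by blast
    obtain \<delta> C where C: "z = Idm \<delta> C" "C \<in> \<B>_at \<delta>" using filter_Idm_cases[OF \<xi> z(1)] by blast
    have le: "ES_le (Idm (a # \<delta>) C) (Idm (a # \<beta>) A)" "ES_le (Idm (a # \<delta>) C) (Idm (a # \<gamma>) B)"
      using z C by auto
    obtain \<epsilon> where "\<delta> = \<beta> @ \<epsilon>" "C \<subseteq> rel_range A \<epsilon>" using z C by auto
    \<comment> \<open>\<open>A\<close> already consists of ends of paths labelled
      \<open>a # \<beta>\<close>, and extending them by \<open>\<epsilon>\<close> keeps the initial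
      \<open>a\<close>. Hence the lower bound may be prefixed too.\<close>
    then have "C \<subseteq> rng (a # \<delta>)"
      using rel_range_mono[OF \<B>_atD(2)[OF A(2)], of \<epsilon>] rng_append[of "a # \<beta>" \<epsilon>] by auto
    then have "Idm (a # \<delta>) C \<in> stretch a \<xi>"
      using z C by (auto simp: Idm_Cons_in_stretch_iff \<B>_at_def)
    then show ?thesis using le A B ES_le_trans by blast
  qed
qed simp

lemma is_filter_shrink:
  assumes \<eta>: "is_filter \<eta>" and a: "Idm [a] (rng [a]) \<in> \<eta>"
  shows "is_filter (shrink a \<eta>)"
proof (rule is_filterI)
  show "shrink a \<eta> \<subseteq> ES" by (auto simp: shrink_def)
  have ra: "rng [a] \<noteq> {}" "rng [a] \<in> \<B>"
    using filter_in_ES[OF \<eta> a] by (auto simp: Idm_in_ES_iff \<B>_at_def)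
  then have "Idm [] (rng [a]) \<in> shrink a \<eta>"
    using a by (simp add: Idm_in_shrink_iff Idm_in_ES_iff)
  then show "shrink a \<eta> \<noteq> {}" by blast
  show "y \<in> shrink a \<eta>" if x: "x \<in> shrink a \<eta>" and y: "y \<in> ES" and le: "ES_le x y" for x y
  proof -
    obtain \<beta> C where C: "x = Idm \<beta> C" "Idm \<beta> C \<in> ES" "Idm (a # \<beta>) (C \<inter> rng (a # \<beta>)) \<in> \<eta>"
      using x by (auto simp: shrink_def)
    then obtain \<gamma> \<delta> B where yB: "y = Idm \<gamma> B" "\<beta> = \<gamma> @ \<delta>" "C \<subseteq> rel_range B \<delta>"
      using le by (auto simp: ES_le_Idm_iff)
    have B: "B \<in> \<B>_at \<gamma>" "B \<noteq> {}" using y yB by (auto simp: Idm_in_ES_iff)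
    have ES: "Idm (a # \<gamma> @ \<delta>) (C \<inter> rng (a # \<beta>)) \<in> ES" using filter_in_ES[OF \<eta> C(3)] yB by simp
    then have "a # \<gamma> @ \<delta> \<in> labels" by (rule ES_labels)
    then have lab: "a # \<gamma> \<in> labels" "\<delta> \<in> labels"
      using labels_appendD[of "a # \<gamma>" \<delta>] by auto
    have at: "B \<inter> rng (a # \<gamma>) \<in> \<B>_at (a # \<gamma>)" using rng_Int_\<B>_at B lab by blast
    have "rng (a # \<gamma>) \<in> \<B>" using lab \<B>_rng labels1_iff labels_iff by blast
    \<comment> \<open>Weak left-resolving carries the restriction to
      \<open>rng (a # \<gamma>)\<close> along \<open>\<delta>\<close>, so the order survives cutting
      down both sets.\<close>
    then have "rel_range (B \<inter> rng (a # \<gamma>)) \<delta> = rel_range B \<delta> \<inter> rng (a # \<beta>)"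
      using rel_range_Int[OF \<B>_atD(1)[OF B(1)] _ lab(2)] rng_append[of "a # \<gamma>" \<delta>] yB by simp
    then have le': "C \<inter> rng (a # \<beta>) \<subseteq> rel_range (B \<inter> rng (a # \<gamma>)) \<delta>" using yB by auto
    moreover have "C \<inter> rng (a # \<beta>) \<noteq> {}" using ES by (simp add: Idm_in_ES_iff)
    ultimately have "B \<inter> rng (a # \<gamma>) \<noteq> {}" by auto
    then have "Idm (a # \<gamma>) (B \<inter> rng (a # \<gamma>)) \<in> \<eta>"
      using filter_up[OF \<eta> C(3)] le' at yB by (simp add: Idm_in_ES_iff)
    then show ?thesis using y yB by (simp add: Idm_in_shrink_iff)
  qed
  show "\<exists>z\<in>shrink a \<eta>. ES_le z x \<and> ES_le z y"
    if x: "x \<in> shrink a \<eta>" and y: "y \<in> shrink a \<eta>" for x y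
  proof -
    obtain \<beta> B where B: "x = Idm \<beta> B" "Idm (a # \<beta>) (B \<inter> rng (a # \<beta>)) \<in> \<eta>"
      using x by (auto simp: shrink_def)
    obtain \<gamma> C where C: "y = Idm \<gamma> C" "Idm (a # \<gamma>) (C \<inter> rng (a # \<gamma>)) \<in> \<eta>"
      using y by (auto simp: shrink_def)
    obtain z where z: "z \<in> \<eta>" "ES_le z (Idm (a # \<beta>) (B \<inter> rng (a # \<beta>)))"
      "ES_le z (Idm (a # \<gamma>) (C \<inter> rng (a # \<gamma>)))"
      using filter_lower_bound[OF \<eta> B(2) C(2)] by blast
    obtain \<delta> E where E: "z = Idm \<delta> E" "E \<noteq> {}" "E \<in> \<B>_at \<delta>"
      using filter_Idm_cases[OF \<eta> z(1)] by blast
    then obtain \<delta>' where \<delta>': "\<delta> = a # \<delta>'" using z by auto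
    have "Idm \<delta>' E \<in> shrink a \<eta>"
      using E \<delta>' z \<B>_at_ConsD Int_rng_eq by (auto simp: Idm_in_shrink_iff Idm_in_ES_iff)
    moreover have "ES_le (Idm \<delta>' E) (Idm \<epsilon> F)" if le: "ES_le z (Idm (a # \<epsilon>) (F \<inter> S))" for \<epsilon> F S
    proof -
      obtain \<zeta> where "\<delta>' = \<epsilon> @ \<zeta>" "E \<subseteq> rel_range (F \<inter> S) \<zeta>" using le E \<delta>' by auto
      then show ?thesis using rel_range_mono[of "F \<inter> S" F \<zeta>] by auto
    qed
    then have "ES_le (Idm \<delta>' E) x" "ES_le (Idm \<delta>' E) y" using z B(1) C(1) by blast+
    ultimately show ?thesis by blast
  qed
qed simp

text \<open>Only \<open>C \<inter> rng (a # \<beta>)\<close> passes through \<open>stretch\<close>;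
  upward closure recovers \<open>C\<close> from it, and \<open>filter_Int_rng_Cons\<close> gives the
  other direction.\<close>

lemma shrink_stretch:
  assumes \<xi>: "is_filter \<xi>" and a: "Idm [] (rng [a]) \<in> \<xi>"
  shows "shrink a (stretch a \<xi>) = \<xi>"
proof -
  have "Idm \<beta> C \<in> shrink a (stretch a \<xi>) \<longleftrightarrow> Idm \<beta> C \<in> \<xi>" for \<beta> C
  proof
    assume "Idm \<beta> C \<in> shrink a (stretch a \<xi>)"
    then have "Idm \<beta> C \<in> ES" "Idm \<beta> (C \<inter> rng (a # \<beta>)) \<in> \<xi>"
      by (auto simp: Idm_in_shrink_iff Idm_Cons_in_stretch_iff)
    then show "Idm \<beta> C \<in> \<xi>" using filter_up[OF \<xi>, of _ "Idm \<beta> C"] by force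
  next
    assume C: "Idm \<beta> C \<in> \<xi>"
    then show "Idm \<beta> C \<in> shrink a (stretch a \<xi>)"
      using filter_Int_rng_Cons[OF \<xi> a C] filter_in_ES[OF \<xi> C]
      by (auto simp: Idm_in_shrink_iff Idm_Cons_in_stretch_iff)
  qed
  moreover have "Zero \<notin> \<xi>" using \<xi> by (simp add: is_filter_def)
  ultimately have "x \<in> shrink a (stretch a \<xi>) \<longleftrightarrow> x \<in> \<xi>" for x by (cases x) auto
  then show ?thesis by blast
qed

text \<open>Level zero of \<open>\<eta>\<close> is the pullback of level one, as in
  \<open>stretch\<close>. For longer words, comparability with \<open>[a]\<close> forces the first
  letter to be \<open>a\<close>.\<close>

lemma stretch_shrink:
  assumes \<eta>: "is_filter \<eta>" and a: "Idm [a] (rng [a]) \<in> \<eta>"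
  shows "stretch a (shrink a \<eta>) = \<eta>"
proof -
  have "Idm \<gamma> A \<in> stretch a (shrink a \<eta>) \<longleftrightarrow> Idm \<gamma> A \<in> \<eta>" for \<gamma> A
  proof (cases \<gamma>)
    case Nil
    show ?thesis
    proof (cases "A \<in> \<B> \<and> rel_range A [a] \<noteq> {}")
      case True
      then have *: "rel_range A [a] \<in> \<B>_at [a]" using rel_range_single_\<B>_at by blast
      then have "Idm [] (rel_range A [a]) \<in> ES"
        using True \<B>_atD(1)[OF *] by (simp add: Idm_in_ES_iff)
      then show ?thesis
        using * True Nil Int_rng_eq[OF *] filter_Cons_rel_range_iff[OF \<eta> a, of A]
        by (simp add: Idm_Nil_in_stretch_iff Idm_in_shrink_iff)
    next
      case False
      have "Idm [a] {} \<notin> \<eta>" using filter_in_ES[OF \<eta>, of "Idm [a] {}"] by (auto simp: Idm_in_ES_iff)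
      then have "Idm [] A \<notin> \<eta>"
        using False filter_Cons_rel_range_iff[OF \<eta> a, of A] filter_in_ES[OF \<eta>, of "Idm [] A"]
        by (auto simp: Idm_in_ES_iff)
      then show ?thesis
        using False Nil by (auto simp: Idm_Nil_in_stretch_iff Idm_in_shrink_iff Idm_in_ES_iff)
    qed
  next
    case (Cons b \<beta>)
    have "b = a \<and> A \<in> \<B>_at (a # \<beta>) \<and> Idm \<beta> A \<in> ES" if "Idm (b # \<beta>) A \<in> \<eta>"
      using filter_chain[OF \<eta> that a] filter_in_ES[OF \<eta> that] \<B>_at_ConsD
      by (auto simp: Idm_in_ES_iff)
    then show ?thesis
      using Cons Int_rng_eq[of A "a # \<beta>"]
      by (auto simp: Idm_Cons_in_stretch_iff Idm_in_shrink_iff)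
  qed
  moreover have "Zero \<notin> \<eta>" using \<eta> by (simp add: is_filter_def)
  ultimately have "x \<in> stretch a (shrink a \<eta>) \<longleftrightarrow> x \<in> \<eta>" for x by (cases x) auto
  then show ?thesis by blast
qed

lemma stretch_mono: "\<xi> \<subseteq> \<zeta> \<Longrightarrow> stretch a \<xi> \<subseteq> stretch a \<zeta>"
  by (auto simp: stretch_def)

lemma shrink_mono: "\<xi> \<subseteq> \<zeta> \<Longrightarrow> shrink a \<xi> \<subseteq> shrink a \<zeta>"
  by (auto simp: shrink_def)

lemma rng_in_stretch:
  assumes "is_filter \<xi>" "Idm [] (rng [a]) \<in> \<xi>"
  shows "Idm [a] (rng [a]) \<in> stretch a \<xi>"
  using filter_Int_rng_Cons[OF assms assms(2)] assms(2) by (simp add: Idm_Cons_in_stretch_iff)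

lemma rng_in_shrink:
  assumes "is_filter \<eta>" "Idm [a] (rng [a]) \<in> \<eta>"
  shows "Idm [] (rng [a]) \<in> shrink a \<eta>"
  using filter_in_ES[OF assms] assms(2) \<B>_atD(1)
  by (auto simp: Idm_in_shrink_iff Idm_in_ES_iff)


subsection \<open>Agreement with gluing and cutting\<close>

text \<open>Gluing onto a non-empty word reads its lower levels from level one of
  \<open>\<xi>\<close>, while \<open>stretch\<close> reads them from level zero; the pullback
  property of levels makes both agree.\<close>

lemma glue_eq_stretch:
  assumes \<xi>: "is_filter \<xi>" and a: "Idm [] (rng [a]) \<in> \<xi>"
  shows "glue [a] (word_of \<xi>) \<xi> = stretch a \<xi>"
proof -
  define \<alpha> where "\<alpha> = word_of \<xi>"
  define upper where "upper n = {C \<inter> rng ([a] @ wtake n \<alpha>) | C. C \<in> level \<alpha> \<xi> n}" for n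
  \<comment> \<open>The exception for the empty word disappears, since
    \<open>Idm [] (rng [a])\<close> is a member of \<open>\<xi>\<close>.\<close>
  have beg: "beginning \<beta> \<alpha> \<longleftrightarrow> (\<exists>A. Idm \<beta> A \<in> \<xi>)" for \<beta>
    using word_of[OF \<xi>, of \<beta>] a unfolding \<alpha>_def by (cases "\<beta> = []") auto
  have upper: "A \<in> upper (length \<beta>) \<longleftrightarrow> A \<in> \<B>_at (a # \<beta>) \<and> Idm \<beta> A \<in> \<xi>"
    if "beginning \<beta> \<alpha>" for A \<beta>
  proof
    assume "A \<in> upper (length \<beta>)"
    then show "A \<in> \<B>_at (a # \<beta>) \<and> Idm \<beta> A \<in> \<xi>"
      using that filter_Int_rng_Cons[OF \<xi> a, of \<beta>]
      by (auto simp: upper_def level_def beginning_def)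
  next
    assume "A \<in> \<B>_at (a # \<beta>) \<and> Idm \<beta> A \<in> \<xi>"
    then show "A \<in> upper (length \<beta>)"
      using that Int_rng_eq[of A "a # \<beta>"] \<B>_atD(1)[of A "a # \<beta>"]
      by (auto simp: upper_def level_def beginning_def intro!: exI[of _ A])
  qed
  have lev: "A \<in> glue_level [a] \<alpha> \<xi> (length \<gamma>) \<longleftrightarrow> Idm \<gamma> A \<in> stretch a \<xi>"
    if \<gamma>: "beginning \<gamma> (wappend [a] \<alpha>)" for \<gamma> A
  proof (cases "\<alpha> = FinW []")
    case True
    then have lev_eq: "glue_level [a] \<alpha> \<xi> i =
      (if i = 0 then {D \<in> \<B>. rel_range D [a] \<in> upper 0} else upper 0)" for i
      by (simp add: glue_level_def upper_def)
    have "\<gamma> = [] \<or> \<gamma> = [a]" using \<gamma> True by (auto simp: beginning_FinW prefix_Cons)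
    moreover have "rel_range A [a] \<in> \<B>_at [a]" if "A \<in> \<B>" "Idm [] (rel_range A [a]) \<in> \<xi>"
      using that rel_range_single_\<B>_at filter_in_ES[OF \<xi>] Idm_in_ES_iff by blast
    moreover have "D \<in> upper 0 \<longleftrightarrow> D \<in> \<B>_at [a] \<and> Idm [] D \<in> \<xi>" for D
      using upper[of "[]" D] by simp
    ultimately show ?thesis
      by (elim disjE) (simp_all add: lev_eq stretch_iffs, blast)
  next
    case False
    obtain b where b: "wtake 1 \<alpha> = [b]" "beginning [b] \<alpha>" using beginning_wtake_1[OF False] by blast
    then obtain B where B: "Idm [b] B \<in> \<xi>" using beg by blast
    \<comment> \<open>Levels 0 and 1 are both pulled back from level 2 of the glued word, which is
      \<open>upper 1\<close>.\<close>
    have lev_eq: "glue_level [a] \<alpha> \<xi> i =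
      (if i \<le> 1 then {D \<in> \<B>_at (take i [a]). rel_range D (drop i [a] @ [b]) \<in> upper 1}
       else upper (i - 1))" for i
      using False b by (simp add: glue_level_def upper_def)
    have up1: "rel_range D [b] \<in> upper 1 \<longleftrightarrow> Idm [] D \<in> \<xi>" if D: "D \<in> \<B>_at [a]" for D
    proof -
      have "rel_range D [b] \<in> \<B>_at [a, b]" if "Idm [b] (rel_range D [b]) \<in> \<xi>"
        using that filter_in_ES[OF \<xi> that] ES_labels rel_range_\<B>_at[OF D, of "[b]"] by simp
      then show ?thesis
        using upper[OF b(2), of "rel_range D [b]"]
          filter_rel_range_iff[OF \<xi>, of "[]" "[b]" B D] B \<B>_atD(1)[OF D] by auto
    qed
    consider "\<gamma> = []" | "\<gamma> = [a]" | c \<beta> where "\<gamma> = a # c # \<beta>" "beginning (c # \<beta>) \<alpha>"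
      using \<gamma> unfolding beginning_wappend_single by (metis neq_Nil_conv)
    then show ?thesis
    proof cases
      case 1
      have "Idm [] (rel_range A [a]) \<in> \<xi> \<longleftrightarrow> rel_range A [a, b] \<in> upper 1" if "A \<in> \<B>"
      proof (cases "rel_range A [a] = {}")
        case True
        have "Idm \<beta> {} \<notin> \<xi>" for \<beta>
          using filter_in_ES[OF \<xi>, of "Idm \<beta> {}"] by (auto simp: Idm_in_ES_iff)
        then show ?thesis
          using True upper[OF b(2), of "{}"] by (simp add: rel_range_Cons[of _ a "[b]"])
      next
        case False
        then show ?thesis
          using up1 rel_range_single_\<B>_at[OF False that] by (simp add: rel_range_Cons[of _ a "[b]"])
      qed
      then show ?thesis using 1 by (auto simp: lev_eq Idm_Nil_in_stretch_iff)
    next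
      case 2
      then show ?thesis using up1 by (auto simp: lev_eq Idm_Cons_in_stretch_iff)
    next
      case 3
      then show ?thesis using upper[OF 3(2)] by (simp add: lev_eq Idm_Cons_in_stretch_iff)
    qed
  qed
  have "Idm \<gamma> A \<in> glue [a] \<alpha> \<xi> \<longleftrightarrow> Idm \<gamma> A \<in> stretch a \<xi>" for \<gamma> A
  proof -
    have "beginning \<gamma> (wappend [a] \<alpha>)" if "Idm \<gamma> A \<in> stretch a \<xi>"
      using that beg by (cases \<gamma>) (auto simp: stretch_iffs beginning_wappend_single)
    then show ?thesis using lev by (auto simp: glue_def assemble_def)
  qed
  moreover have "Zero \<notin> glue [a] \<alpha> \<xi>" by (auto simp: glue_def assemble_def)
  ultimately have "x \<in> glue [a] \<alpha> \<xi> \<longleftrightarrow> x \<in> stretch a \<xi>" for x by (cases x) auto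
  then show ?thesis unfolding \<alpha>_def by blast
qed

text \<open>A set \<open>D\<close> in the level at \<open>a # \<gamma>\<close> lies in
  \<open>rng (a # \<gamma>)\<close>, so \<open>C \<inter> rng (a # \<gamma>)\<close> is the largest
  candidate inside \<open>C\<close>; by upward closure it is in the level as soon as any candidate
  is.\<close>

lemma cut_eq_shrink:
  assumes \<eta>: "is_filter \<eta>" and a: "Idm [a] (rng [a]) \<in> \<eta>"
  shows "cut [a] (wdrop 1 (word_of \<eta>)) \<eta> = shrink a \<eta>"
proof -
  define \<beta> where "\<beta> = wdrop 1 (word_of \<eta>)"
  have word: "wappend [a] \<beta> = word_of \<eta>"
    using word_of[OF \<eta>, of "[a]"] a wappend_wdrop_1[of a "word_of \<eta>"] unfolding \<beta>_def by auto
  have beg: "beginning \<gamma> \<beta> \<longleftrightarrow> (\<exists>A. Idm (a # \<gamma>) A \<in> \<eta>)" for \<gamma>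
    using word_of[OF \<eta>, of "a # \<gamma>"] by (simp add: beginning_wappend_single flip: word)
  have "Idm \<gamma> C \<in> cut [a] \<beta> \<eta> \<longleftrightarrow> Idm \<gamma> C \<in> shrink a \<eta>" for \<gamma> C
  proof (cases "beginning \<gamma> \<beta>")
    case True
    then have lev: "level (wappend [a] \<beta>) \<eta> (length \<gamma> + 1) = {A \<in> \<B>. Idm (a # \<gamma>) A \<in> \<eta>}"
      by (cases \<beta>) (auto simp: level_def beginning_def)
    have "Idm \<gamma> C \<in> cut [a] \<beta> \<eta> \<longleftrightarrow> C \<in> \<B>_at \<gamma> \<and> (\<exists>D\<in>\<B>. Idm (a # \<gamma>) D \<in> \<eta> \<and> D \<subseteq> C)"
      using True lev by (auto simp: cut_def assemble_def cut_level_def beginning_def)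
    also have "\<dots> \<longleftrightarrow> Idm \<gamma> C \<in> shrink a \<eta>"
    proof
      assume "C \<in> \<B>_at \<gamma> \<and> (\<exists>D\<in>\<B>. Idm (a # \<gamma>) D \<in> \<eta> \<and> D \<subseteq> C)"
      then obtain D where D: "C \<in> \<B>_at \<gamma>" "Idm (a # \<gamma>) D \<in> \<eta>" "D \<subseteq> C" by blast
      then have ES: "Idm (a # \<gamma>) D \<in> ES" using filter_in_ES[OF \<eta>] by blast
      then have "D \<subseteq> C \<inter> rng (a # \<gamma>)" "D \<noteq> {}" using D by (auto simp: Idm_in_ES_iff \<B>_at_def)
      moreover have "C \<inter> rng (a # \<gamma>) \<in> \<B>_at (a # \<gamma>)"
        using rng_Int_\<B>_at D(1) ES_labels[OF ES] by blast
      ultimately show "Idm \<gamma> C \<in> shrink a \<eta>"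
        using filter_up[OF \<eta> D(2), of "Idm (a # \<gamma>) (C \<inter> rng (a # \<gamma>))"] D(1)
        by (auto simp: Idm_in_shrink_iff Idm_in_ES_iff)
    next
      assume C: "Idm \<gamma> C \<in> shrink a \<eta>"
      then have "Idm (a # \<gamma>) (C \<inter> rng (a # \<gamma>)) \<in> \<eta>" by (simp add: Idm_in_shrink_iff)
      moreover from this have "C \<inter> rng (a # \<gamma>) \<in> \<B>"
        using filter_in_ES[OF \<eta>] Idm_in_ES_iff \<B>_atD(1) by blast
      ultimately show "C \<in> \<B>_at \<gamma> \<and> (\<exists>D\<in>\<B>. Idm (a # \<gamma>) D \<in> \<eta> \<and> D \<subseteq> C)"
        using C by (auto simp: Idm_in_shrink_iff Idm_in_ES_iff)
    qed
    finally show ?thesis .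
  next
    case False
    then show ?thesis
      using beg by (auto simp: cut_def assemble_def Idm_in_shrink_iff)
  qed
  moreover have "Zero \<notin> cut [a] \<beta> \<eta>" by (auto simp: cut_def assemble_def)
  ultimately have "x \<in> cut [a] \<beta> \<eta> \<longleftrightarrow> x \<in> shrink a \<eta>" for x by (cases x) auto
  then show ?thesis unfolding \<beta>_def by blast
qed

end


section \<open>The action on the tight spectrum\<close>

context labelled_space
begin

section \<open>The topology on the space of filters\<close>

lemma topspace_filter_topology [simp]: "topspace filter_topology = {\<xi>. is_filter \<xi>}"
  by (auto simp: filter_topology_def topspace_pullback_topology)

lemma continuous_map_mem:
  "continuous_map filter_topology (discrete_topology UNIV) (\<lambda>\<xi>. e \<in> \<xi>)"
proof (cases "e \<in> ES")
  case True
  have "continuous_map filter_topology (discrete_topology UNIV) ((\<lambda>h. h e) \<circ> (\<lambda>\<xi>. \<lambda>e\<in>ES. e \<in> \<xi>))"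
    unfolding filter_topology_def
    by (intro continuous_map_pullback continuous_map_product_projection True)
  then show ?thesis using True by (simp add: comp_def)
next
  case False
  have "continuous_map filter_topology (discrete_topology UNIV) (\<lambda>\<xi>. False)" by simp
  then show ?thesis
    by (rule continuous_map_eq) (use False filter_in_ES in auto)
qed

lemma continuous_map_filter_topologyI:
  assumes "\<And>\<xi>. \<xi> \<in> topspace Y \<Longrightarrow> is_filter (f \<xi>)"
    and "\<And>e. e \<in> ES \<Longrightarrow> continuous_map Y (discrete_topology UNIV) (\<lambda>\<xi>. e \<in> f \<xi>)"
  shows "continuous_map Y filter_topology f"
  unfolding filter_topology_def
proof (rule continuous_map_pullback')
  show "continuous_map Y (product_topology (\<lambda>_. discrete_topology UNIV) ES)
      ((\<lambda>\<xi>. \<lambda>e\<in>ES. e \<in> \<xi>) \<circ> f)"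
    using assms(2) by (auto simp: continuous_map_componentwise extensional_def)
qed (use assms(1) in auto)

lemma openin_mem: "openin filter_topology {\<xi>. is_filter \<xi> \<and> e \<in> \<xi>}"
  using openin_continuous_map_preimage[OF continuous_map_mem[of e], of "{True}"] by simp

lemma openin_V_idem: "openin tight_spectrum (V_idem e)"
proof -
  have "V_idem e = tight \<inter> {\<xi>. is_filter \<xi> \<and> e \<in> \<xi>}"
    using closure_of_subset_topspace[of filter_topology] by (auto simp: V_idem_def tight_def)
  then show ?thesis
    unfolding tight_spectrum_def by (simp add: openin_subtopology_Int2 openin_mem)
qed

lemma tight_imp_filter: "\<xi> \<in> tight \<Longrightarrow> is_filter \<xi>"
  using closure_of_subset_topspace[of filter_topology] by (auto simp: tight_def)

lemma tight_open_ultrafilter: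
  "\<lbrakk>\<xi> \<in> tight; openin filter_topology N; \<xi> \<in> N\<rbrakk> \<Longrightarrow> \<exists>u. is_ultrafilter u \<and> u \<in> N"
  by (auto simp: tight_def in_closure_of)

lemma topspace_tight_spectrum [simp]: "topspace tight_spectrum = tight"
  using tight_imp_filter by (auto simp: tight_spectrum_def)

text \<open>
  Monotone mutually inverse maps between the filters containing \<open>d\<close> and those containing \<open>e\<close>
  match ultrafilters with ultrafilters, because both sets of filters are upward closed.
\<close>

lemma tight_transfer:
  assumes f: "\<And>\<xi>. \<lbrakk>is_filter \<xi>; d \<in> \<xi>\<rbrakk> \<Longrightarrow> is_filter (f \<xi>) \<and> e \<in> f \<xi> \<and> g (f \<xi>) = \<xi>"
    and g: "\<And>\<eta>. \<lbrakk>is_filter \<eta>; e \<in> \<eta>\<rbrakk> \<Longrightarrow> is_filter (g \<eta>) \<and> d \<in> g \<eta> \<and> f (g \<eta>) = \<eta>"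
    and g_mono: "\<And>\<eta> \<zeta>. \<eta> \<subseteq> \<zeta> \<Longrightarrow> g \<eta> \<subseteq> g \<zeta>"
    and cont: "continuous_map (subtopology filter_topology {\<xi>. d \<in> \<xi>}) filter_topology f"
    and \<xi>: "\<xi> \<in> tight" "d \<in> \<xi>"
  shows "f \<xi> \<in> tight"
  unfolding tight_def in_closure_of
proof (intro conjI allI impI)
  have fil: "is_filter \<xi>" using \<xi> tight_imp_filter by blast
  then show "f \<xi> \<in> topspace filter_topology" using f \<xi> by simp
  fix N assume N: "f \<xi> \<in> N \<and> openin filter_topology N"
  let ?U = "{\<zeta>. is_filter \<zeta> \<and> d \<in> \<zeta>}" and ?M = "{\<zeta>. is_filter \<zeta> \<and> d \<in> \<zeta> \<and> f \<zeta> \<in> N}"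
  have "openin (subtopology filter_topology {\<xi>. d \<in> \<xi>}) ?M"
    using openin_continuous_map_preimage[OF cont, of N] N by (simp add: Collect_conj_eq Int_ac)
  \<comment> \<open>Cutting down to filters makes the subspace an open set, so that relatively open
    sets are open and meet the ultrafilters near \<open>\<xi>\<close>.\<close>
  moreover have "subtopology filter_topology {\<xi>. d \<in> \<xi>} = subtopology filter_topology ?U"
    using subtopology_restrict[of filter_topology "{\<xi>. d \<in> \<xi>}"] by (simp add: Collect_conj_eq)
  ultimately have "openin (subtopology filter_topology ?U) ?M" by simp
  then have "openin filter_topology ?M"
    by (simp only: openin_open_subtopology[OF openin_mem])
  moreover have "\<xi> \<in> ?M" using fil \<xi> N by simp
  ultimately obtain u where u: "is_ultrafilter u" "u \<in> ?M"
    using tight_open_ultrafilter[OF \<xi>(1)] by meson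
  \<comment> \<open>A filter above \<open>f u\<close> still contains \<open>e\<close>, so it can be
    sent back by \<open>g\<close>, where maximality of \<open>u\<close> applies.\<close>
  have "\<zeta> = f u" if \<zeta>: "is_filter \<zeta>" "f u \<subseteq> \<zeta>" for \<zeta>
  proof -
    have "e \<in> \<zeta>" using \<zeta> u f by blast
    then have *: "is_filter (g \<zeta>)" "f (g \<zeta>) = \<zeta>" using g \<zeta> by auto
    have "u \<subseteq> g \<zeta>" using g_mono[OF \<zeta>(2)] f[of u] u by auto
    then have "g \<zeta> = u" using u * by (auto simp: is_ultrafilter_def)
    then show ?thesis using * by simp
  qed
  then have "is_ultrafilter (f u)" using u f by (auto simp: is_ultrafilter_def)
  then show "\<exists>y. y \<in> {\<xi>. is_ultrafilter \<xi>} \<and> y \<in> N" using u by blast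
qed

text \<open>Each coordinate of the image depends on at most one coordinate of \<open>\<xi>\<close>,
  with \<open>P\<close> independent of \<open>\<xi>\<close>. This is the source of
  continuity.\<close>

lemma stretch_membership: "\<exists>P y. \<forall>\<xi>. x \<in> stretch a \<xi> \<longleftrightarrow> P \<and> y \<in> \<xi>"
proof (cases x)
  case Zero
  then show ?thesis by auto
next
  case (Idm \<gamma> A)
  then show ?thesis
    by (cases \<gamma>) (simp_all only: Idm Idm_Cons_in_stretch_iff Idm_Nil_in_stretch_iff, blast+)
qed

lemma shrink_membership: "\<exists>P y. \<forall>\<eta>. x \<in> shrink a \<eta> \<longleftrightarrow> P \<and> y \<in> \<eta>"
proof (cases x)
  case Zero
  then show ?thesis by auto
next
  case (Idm \<gamma> A)
  then show ?thesis by (simp only: Idm Idm_in_shrink_iff) blast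
qed

lemma continuous_map_membershipI:
  assumes "\<And>\<xi>. is_filter \<xi> \<Longrightarrow> \<xi> \<in> S \<Longrightarrow> is_filter (f \<xi>)"
    and mem: "\<And>x. \<exists>P y. \<forall>\<xi>. x \<in> f \<xi> \<longleftrightarrow> P \<and> y \<in> \<xi>"
  shows "continuous_map (subtopology filter_topology S) filter_topology f"
proof (rule continuous_map_filter_topologyI)
  fix x
  obtain P y where "\<And>\<xi>. x \<in> f \<xi> \<longleftrightarrow> P \<and> y \<in> \<xi>" using mem by blast
  then show "continuous_map (subtopology filter_topology S) (discrete_topology UNIV) (\<lambda>\<xi>. x \<in> f \<xi>)"
    using continuous_map_from_subtopology[OF continuous_map_mem] by (cases P) auto
qed (use assms(1) in auto)

end

context normal_labelled_space
begin

lemma continuous_map_stretch: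
  "continuous_map (subtopology filter_topology {\<xi>. Idm [] (rng [a]) \<in> \<xi>}) filter_topology (stretch a)"
  using is_filter_stretch stretch_membership by (intro continuous_map_membershipI) auto

lemma continuous_map_shrink:
  "continuous_map (subtopology filter_topology {\<eta>. Idm [a] (rng [a]) \<in> \<eta>}) filter_topology (shrink a)"
  using is_filter_shrink shrink_membership by (intro continuous_map_membershipI) auto

lemma stretch_in_V:
  assumes "\<xi> \<in> V_letter (Neg a)"
  shows "stretch a \<xi> \<in> V_letter (Pos a)"
proof -
  have \<xi>: "\<xi> \<in> tight" "Idm [] (rng [a]) \<in> \<xi>" using assms by (auto simp: V_idem_def)
  have "stretch a \<xi> \<in> tight"
    by (rule tight_transfer[where f="stretch a" and g="shrink a" and e="Idm [a] (rng [a])",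
          OF _ _ shrink_mono continuous_map_stretch \<xi>])
      (simp_all add: is_filter_stretch is_filter_shrink rng_in_stretch rng_in_shrink
        shrink_stretch stretch_shrink)
  then show ?thesis using \<xi> rng_in_stretch tight_imp_filter by (simp add: V_idem_def)
qed

lemma shrink_in_V:
  assumes "\<eta> \<in> V_letter (Pos a)"
  shows "shrink a \<eta> \<in> V_letter (Neg a)"
proof -
  have \<eta>: "\<eta> \<in> tight" "Idm [a] (rng [a]) \<in> \<eta>" using assms by (auto simp: V_idem_def)
  have "shrink a \<eta> \<in> tight"
    by (rule tight_transfer[where f="shrink a" and g="stretch a" and e="Idm [] (rng [a])",
          OF _ _ stretch_mono continuous_map_shrink \<eta>])
      (simp_all add: is_filter_stretch is_filter_shrink rng_in_stretch rng_in_shrink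
        shrink_stretch stretch_shrink)
  then show ?thesis using \<eta> rng_in_shrink tight_imp_filter by (simp add: V_idem_def)
qed

lemma \<phi>_letter_Pos: "\<xi> \<in> V_letter (Neg a) \<Longrightarrow> \<phi>_letter (Pos a) \<xi> = stretch a \<xi>"
  using glue_eq_stretch tight_imp_filter by (auto simp: V_idem_def)

lemma \<phi>_letter_Neg: "\<eta> \<in> V_letter (Pos a) \<Longrightarrow> \<phi>_letter (Neg a) \<eta> = shrink a \<eta>"
  using cut_eq_shrink tight_imp_filter by (auto simp: V_idem_def)

text \<open>\<open>h\<close> is meant for \<open>\<phi>_letter\<close>, which is only known to agree
  with the continuous conjugation \<open>f\<close> on \<open>V_idem d\<close>.\<close>

lemma continuous_map_tight_spectrum_restrict:
  assumes "continuous_map (subtopology filter_topology {\<xi>. d \<in> \<xi>}) filter_topology f"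
    and "\<And>\<xi>. \<xi> \<in> V_idem d \<Longrightarrow> f \<xi> \<in> V_idem e \<and> h \<xi> = f \<xi>"
  shows "continuous_map (subtopology tight_spectrum (V_idem d)) (subtopology tight_spectrum (V_idem e)) h"
proof -
  have "continuous_map (subtopology filter_topology (V_idem d)) filter_topology f"
    by (rule continuous_map_from_subtopology_mono[OF assms(1)]) (auto simp: V_idem_def)
  then have "continuous_map (subtopology filter_topology (V_idem d)) filter_topology h"
    by (rule continuous_map_eq) (use assms(2) in auto)
  moreover have "tight \<inter> V_idem x = V_idem x" for x by (auto simp: V_idem_def)
  ultimately show ?thesis
    using assms(2) by (auto simp: tight_spectrum_def subtopology_subtopology continuous_map_in_subtopology)
qed

sublocale letter_homeos tight_spectrum V_letter \<phi>_letter
proof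
  show "openin tight_spectrum (V_letter x)" for x
    by (cases x) (auto simp: openin_V_idem)
  show "continuous_map (subtopology tight_spectrum (V_letter (inv_letter x)))
      (subtopology tight_spectrum (V_letter x)) (\<phi>_letter x)" for x
  proof (cases x)
    case (Pos a)
    then show ?thesis
      using continuous_map_tight_spectrum_restrict[OF continuous_map_stretch[of a], of _ "\<phi>_letter x"]
        stretch_in_V[of _ a] \<phi>_letter_Pos[of _ a] by simp
  next
    case (Neg a)
    then show ?thesis
      using continuous_map_tight_spectrum_restrict[OF continuous_map_shrink[of a], of _ "\<phi>_letter x"]
        shrink_in_V[of _ a] \<phi>_letter_Neg[of _ a] by simp
  qed
  show "\<phi>_letter (inv_letter x) (\<phi>_letter x \<xi>) = \<xi>" if \<xi>: "\<xi> \<in> V_letter (inv_letter x)" for x \<xi>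
  proof (cases x)
    case (Pos a)
    then show ?thesis
      using \<xi> \<phi>_letter_Pos[of \<xi> a] \<phi>_letter_Neg[OF stretch_in_V[of \<xi> a]]
        shrink_stretch[of \<xi> a] tight_imp_filter by (simp add: V_idem_def del: \<phi>_letter.simps)
  next
    case (Neg a)
    then show ?thesis
      using \<xi> \<phi>_letter_Neg[of \<xi> a] \<phi>_letter_Pos[OF shrink_in_V[of \<xi> a]]
        stretch_shrink[of \<xi> a] tight_imp_filter by (simp add: V_idem_def del: \<phi>_letter.simps)
  qed
qed

lemma \<phi>_eq_act: "\<phi> = act"
proof (intro ext)
  show "\<phi> w \<xi> = act w \<xi>" for w \<xi> by (induction w \<xi> rule: \<phi>.induct) auto
qed

lemma V_inv_eq_act_dom: "V_inv w = act_dom w"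
proof (induction w rule: V_inv.induct)
  \<comment> \<open>The one-letter clause does not mention \<open>tight\<close>, but
    \<open>V_idem\<close> contains that condition.\<close>
  case (2 a)
  then show ?case by (cases a) (auto simp: V_idem_def)
qed (simp_all add: \<phi>_eq_act)

lemma V_eq_act_dom: "V = (\<lambda>t. act_dom (inv\<^bsub>free_group \<A>\<^esub> t))"
  by (simp add: fun_eq_iff V_def V_inv_eq_act_dom)

lemma orthogonal_V: "orthogonal_action \<A> V"
proof -
  \<comment> \<open>\<open>V\<close> inverts the word and \<open>V_inv\<close> inverts the letter
    again. The two sets are then disjoint because words occurring in one filter are
    prefix-comparable.\<close>
  have V_single: "V [Pos a] = V_idem (Idm [a] (rng [a]))" if "a \<in> \<A>" for a
  proof -
    have "[Pos a] \<in> carrier (free_group \<A>)" using that by (simp add: free_group_def)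
    then show ?thesis by (simp add: V_def inv_free_group)
  qed
  have "a = b" if "\<xi> \<in> V_idem (Idm [a] (rng [a]))" "\<xi> \<in> V_idem (Idm [b] (rng [b]))" for a b \<xi>
    using that filter_chain[OF tight_imp_filter, of \<xi> "[a]" _ "[b]"] by (auto simp: V_idem_def)
  then show ?thesis by (auto simp: orthogonal_action_def V_single)
qed

end

theorem proposition3p12:
  fixes \<E> :: "('v, 'e) pre_digraph" and L :: "'e \<Rightarrow> 'a" and \<A> :: "'a set"
    and \<B> :: "'v set set"
  assumes "normal_labelled_space \<E> L \<A> \<B>"
  shows "partial_action (free_group \<A>) (labelled_space.tight_spectrum \<E> L \<B>)
      (labelled_space.V \<E> L \<A> \<B>) (labelled_space.\<phi> \<E> L \<B>)
    \<and> semi_saturated \<A> (labelled_space.V \<E> L \<A> \<B>) (labelled_space.\<phi> \<E> L \<B>)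
    \<and> orthogonal_action \<A> (labelled_space.V \<E> L \<A> \<B>)"
proof -
  interpret normal_labelled_space \<E> L \<A> \<B> by (fact assms)
  show ?thesis
    using partial_action_act semi_saturated_act orthogonal_V
    by (simp add: V_eq_act_dom \<phi>_eq_act)
qed

end
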